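(* Among the nonzero $3$-dimensional complex associative algebras $d_1,\dots,d_{21}$, $d_{22}(x:y)$ listed in the context, the following seven, and no members outside these seven, have no nontrivial deformations: $d_7$, $d_8$, $d_{10}$, $d_{11}$, $d_{13}$, $d_{14}$, $d_{20}$. Moreover, none of the listed algebras has a jump deformation to $d_8$ or to $d_{20}$.
   Context: Associative algebras are not assumed unital or commutative. $V$ is a complex vector space with basis $e_1,e_2,e_3$, and $\psi^{i,j}_k$ denotes the bilinear map $V\times V\to V$ with $\psi^{i,j}_k(e_i,e_j)=e_k$ and $\psi^{i,j}_k(e_m,e_n)=0$ for $(m,n)\neq(i,j)$. An algebra structure is identified with its product $d$. Deformations: a one-parameter formal deformation of $d$ is an associative $\mathbb{C}[[t]]$-bilinear product $d_t=d+t\psi_1+t^2\psi_2+\cdots$ on $V[[t]]$ with bilinear $\psi_i:V\times V\to V$; it is trivial if it is equivalent to $d$ via a $\mathbb{C}[[t]]$-linear automorphism of $V[[t]]$ reducing to the identity at $t=0$. "No nontrivial deformations" means every formal deformation is trivial. A jump deformation from $d$ to a non-isomorphic structure $d'$ is a family $d_t=d+t\psi_1+t^2\psi_2+\cdots$ of associative products on $V$, given by a power series convergent for small $t$, such that $d_t$ is isomorphic to $d'$ for all sufficiently small $t\neq 0$. The list of products is: $d_1=\psi^{1,1}_1$; $d_2=\psi^{1,1}_1+\psi^{2,2}_3$; $d_3=\psi^{1,1}_1+\psi^{1,3}_3$; $d_4=\psi^{1,1}_1+\psi^{3,1}_3$; $d_5=\psi^{1,1}_1+\psi^{1,3}_3+\psi^{3,1}_3$;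 $d_6=\psi^{1,1}_1+\psi^{3,3}_3$; $d_7=\psi^{1,1}_1+\psi^{2,1}_2+\psi^{1,3}_3$; $d_8=\psi^{1,1}_1+\psi^{2,1}_2+\psi^{3,1}_3$; $d_9=\psi^{1,1}_1+\psi^{2,1}_2+\psi^{1,3}_3+\psi^{3,1}_3$; $d_{10}=\psi^{1,1}_1+\psi^{2,1}_2+\psi^{3,3}_3$; $d_{11}=\psi^{1,1}_1+\psi^{2,2}_2+\psi^{2,3}_3$; $d_{12}=\psi^{1,1}_1+\psi^{2,2}_2+\psi^{2,3}_3+\psi^{3,2}_3$; $d_{13}=\psi^{1,1}_1+\psi^{2,2}_2+\psi^{2,3}_3+\psi^{3,1}_3$; $d_{14}=\psi^{1,1}_1+\psi^{2,2}_2+\psi^{3,3}_3$; $d_{15}=\psi^{1,1}_2$; $d_{16}=\psi^{1,1}_2+\psi^{1,2}_3+\psi^{2,1}_3$; $d_{17}=\psi^{1,1}_1+\psi^{1,1}_2+\psi^{1,2}_2+\psi^{2,1}_2+\psi^{1,3}_3$; $d_{18}=\psi^{1,1}_1+\psi^{1,1}_2+\psi^{1,2}_2+\psi^{2,1}_2+\psi^{1,3}_3+\psi^{3,1}_3$; $d_{19}=\psi^{3,3}_3+\psi^{1,1}_2+\psi^{1,3}_1+\psi^{3,1}_1+\psi^{2,3}_2+\psi^{3,2}_2$; $d_{20}=\psi^{1,1}_1+\psi^{1,2}_2+\psi^{1,3}_3$; $d_{21}=\psi^{1,1}_3+\psi^{1,2}_3-\psi^{2,1}_3$; $d_{22}(x:y)=x\,\psi^{1,2}_3+y\,\psi^{2,1}_3$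 for $(x:y)\in\mathbb{P}^1(\mathbb{C})$. *)

theory Defs
  imports "HOL-Analysis.Analysis" "HOL-Computational_Algebra.Formal_Power_Series"
begin

section \<open>Products on free modules of rank three\<close>

text \<open>
  \<open>V\<close> is \<open>complex ^ 3\<close> with basis \<open>e\<^sub>i = axis i 1\<close>, and \<open>V[[t]]\<close> is \<open>complex fps ^ 3\<close>.
  The index type \<open>3\<close> has the elements \<open>1\<close>, \<open>2\<close>, \<open>3\<close> (where \<open>3 = 0\<close>). Linearity is always over
  the full coefficient ring, hence \<^const>\<open>module_hom\<close> rather than the real-linear
  \<^const>\<open>bilinear\<close>.
\<close>

type_synonym 'a prod3 = "'a ^ 3 \<Rightarrow> 'a ^ 3 \<Rightarrow> 'a ^ 3"

definition bilinear_over :: "'a::comm_ring_1 prod3 \<Rightarrow> bool" where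
  "bilinear_over d \<longleftrightarrow>
     (\<forall>x. module_hom (*s) (*s) (\<lambda>y. d x y)) \<and> (\<forall>y. module_hom (*s) (*s) (\<lambda>x. d x y))"

definition assoc_algebra :: "'a::comm_ring_1 prod3 \<Rightarrow> bool" where
  "assoc_algebra d \<longleftrightarrow> bilinear_over d \<and> (\<forall>x y z. d (d x y) z = d x (d y z))"

definition algebra_iso :: "'a::comm_ring_1 prod3 \<Rightarrow> 'a prod3 \<Rightarrow> ('a ^ 3 \<Rightarrow> 'a ^ 3) \<Rightarrow> bool" where
  "algebra_iso d d' f \<longleftrightarrow>
     module_hom (*s) (*s) f \<and> bij f \<and> (\<forall>x y. f (d x y) = d' (f x) (f y))"

definition isomorphic :: "'a::comm_ring_1 prod3 \<Rightarrow> 'a prod3 \<Rightarrow> bool" where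
  "isomorphic d d' \<longleftrightarrow> (\<exists>f. algebra_iso d d' f)"


section \<open>Formal deformations\<close>

definition vseries :: "(nat \<Rightarrow> complex ^ 3) \<Rightarrow> complex fps ^ 3" where
  "vseries c = (\<chi> k. Abs_fps (\<lambda>n. c n $ k))"

definition vcoeff :: "complex fps ^ 3 \<Rightarrow> nat \<Rightarrow> complex ^ 3" where
  "vcoeff x n = (\<chi> k. fps_nth (x $ k) n)"

definition vconst :: "complex ^ 3 \<Rightarrow> complex fps ^ 3" where
  "vconst v = (\<chi> k. fps_const (v $ k))"

text \<open>
  A \<open>\<complex>[[t]]\<close>-bilinear product on \<open>V[[t]]\<close> is determined by its values on constants, so the
  last condition says that \<open>D = d + t \<psi>\<^sub>1 + t\<^sup>2 \<psi>\<^sub>2 + \<dots>\<close> with \<open>\<psi>\<^sub>0 = d\<close>.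
\<close>

definition formal_deformation :: "complex prod3 \<Rightarrow> complex fps prod3 \<Rightarrow> bool" where
  "formal_deformation d D \<longleftrightarrow>
     assoc_algebra D \<and>
     (\<exists>\<psi> :: nat \<Rightarrow> complex prod3.
        \<psi> 0 = d \<and> (\<forall>n. bilinear_over (\<psi> n)) \<and>
        (\<forall>v w. D (vconst v) (vconst w) = vseries (\<lambda>n. \<psi> n v w)))"

text \<open>The \<open>\<complex>[[t]]\<close>-bilinear extension of \<open>d\<close> to \<open>V[[t]]\<close>, written in the basis \<open>e\<^sub>i\<close>.\<close>

definition extend_product :: "complex prod3 \<Rightarrow> complex fps prod3" where
  "extend_product d x y = (\<Sum>i\<in>UNIV. \<Sum>j\<in>UNIV. (x $ i * y $ j) *s vconst (d (axis i 1) (axis j 1)))"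

definition trivial_deformation :: "complex prod3 \<Rightarrow> complex fps prod3 \<Rightarrow> bool" where
  "trivial_deformation d D \<longleftrightarrow>
     (\<exists>\<Phi>. algebra_iso D (extend_product d) \<Phi> \<and> (\<forall>x. vcoeff (\<Phi> x) 0 = vcoeff x 0))"

definition no_nontrivial_deformations :: "complex prod3 \<Rightarrow> bool" where
  "no_nontrivial_deformations d \<longleftrightarrow> (\<forall>D. formal_deformation d D \<longrightarrow> trivial_deformation d D)"


section \<open>Jump deformations\<close>

definition jump_deformation :: "complex prod3 \<Rightarrow> complex prod3 \<Rightarrow> bool" where
  "jump_deformation d d' \<longleftrightarrow>
     \<not> isomorphic d d' \<and>
     (\<exists>(\<psi> :: nat \<Rightarrow> complex prod3) (D :: complex \<Rightarrow> complex prod3).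
        \<psi> 0 = d \<and> (\<forall>n. bilinear_over (\<psi> n)) \<and>
        (\<forall>\<^sub>F t in nhds 0. assoc_algebra (D t) \<and> (\<forall>v w. (\<lambda>n. t ^ n *s \<psi> n v w) sums D t v w)) \<and>
        (\<forall>\<^sub>F t in at 0. isomorphic (D t) d'))"


section \<open>The list of algebras\<close>

definition psi :: "3 \<Rightarrow> 3 \<Rightarrow> 3 \<Rightarrow> complex prod3" where
  "psi i j k v w = axis k (v $ i * w $ j)"

definition d1 :: "complex prod3" where
  "d1 v w = psi 1 1 1 v w"
definition d2 :: "complex prod3" where
  "d2 v w = psi 1 1 1 v w + psi 2 2 3 v w"
definition d3 :: "complex prod3" where
  "d3 v w = psi 1 1 1 v w + psi 1 3 3 v w"
definition d4 :: "complex prod3" where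
  "d4 v w = psi 1 1 1 v w + psi 3 1 3 v w"
definition d5 :: "complex prod3" where
  "d5 v w = psi 1 1 1 v w + psi 1 3 3 v w + psi 3 1 3 v w"
definition d6 :: "complex prod3" where
  "d6 v w = psi 1 1 1 v w + psi 3 3 3 v w"
definition d7 :: "complex prod3" where
  "d7 v w = psi 1 1 1 v w + psi 2 1 2 v w + psi 1 3 3 v w"
definition d8 :: "complex prod3" where
  "d8 v w = psi 1 1 1 v w + psi 2 1 2 v w + psi 3 1 3 v w"
definition d9 :: "complex prod3" where
  "d9 v w = psi 1 1 1 v w + psi 2 1 2 v w + psi 1 3 3 v w + psi 3 1 3 v w"
definition d10 :: "complex prod3" where
  "d10 v w = psi 1 1 1 v w + psi 2 1 2 v w + psi 3 3 3 v w"
definition d11 :: "complex prod3" where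
  "d11 v w = psi 1 1 1 v w + psi 2 2 2 v w + psi 2 3 3 v w"
definition d12 :: "complex prod3" where
  "d12 v w = psi 1 1 1 v w + psi 2 2 2 v w + psi 2 3 3 v w + psi 3 2 3 v w"
definition d13 :: "complex prod3" where
  "d13 v w = psi 1 1 1 v w + psi 2 2 2 v w + psi 2 3 3 v w + psi 3 1 3 v w"
definition d14 :: "complex prod3" where
  "d14 v w = psi 1 1 1 v w + psi 2 2 2 v w + psi 3 3 3 v w"
definition d15 :: "complex prod3" where
  "d15 v w = psi 1 1 2 v w"
definition d16 :: "complex prod3" where
  "d16 v w = psi 1 1 2 v w + psi 1 2 3 v w + psi 2 1 3 v w"
definition d17 :: "complex prod3" where
  "d17 v w = psi 1 1 1 v w + psi 1 1 2 v w + psi 1 2 2 v w + psi 2 1 2 v w + psi 1 3 3 v w"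
definition d18 :: "complex prod3" where
  "d18 v w = psi 1 1 1 v w + psi 1 1 2 v w + psi 1 2 2 v w + psi 2 1 2 v w + psi 1 3 3 v w
             + psi 3 1 3 v w"
definition d19 :: "complex prod3" where
  "d19 v w = psi 3 3 3 v w + psi 1 1 2 v w + psi 1 3 1 v w + psi 3 1 1 v w + psi 2 3 2 v w
             + psi 3 2 2 v w"
definition d20 :: "complex prod3" where
  "d20 v w = psi 1 1 1 v w + psi 1 2 2 v w + psi 1 3 3 v w"
definition d21 :: "complex prod3" where
  "d21 v w = psi 1 1 3 v w + psi 1 2 3 v w - psi 2 1 3 v w"
definition d22 :: "complex \<Rightarrow> complex \<Rightarrow> complex prod3" where
  "d22 x y v w = x *s psi 1 2 3 v w + y *s psi 2 1 3 v w"

text \<open>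
  A point \<open>(x:y)\<close> of the projective line is given by any pair of homogeneous coordinates
  \<open>(x, y) \<noteq> (0, 0)\<close>; rescaling the pair yields an isomorphic algebra.
\<close>

definition listed_algebras :: "complex prod3 set" where
  "listed_algebras =
     {d1, d2, d3, d4, d5, d6, d7, d8, d9, d10, d11, d12, d13, d14, d15, d16, d17, d18, d19, d20, d21}
     \<union> {d22 x y | x y. (x, y) \<noteq> (0, 0)}"


section \<open>Consistency of the encoding\<close>

lemma psi_axis:
  "psi i j k (axis m 1) (axis n 1) = (if m = i \<and> n = j then axis k 1 else 0)"
  by (auto simp: psi_def axis_def vec_eq_iff)

lemma module_vec3: "module ((*s) :: 'a::comm_ring_1 \<Rightarrow> 'a ^ 3 \<Rightarrow> 'a ^ 3)"
  by unfold_locales (auto simp: vec_eq_iff algebra_simps)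

lemma module_hom_vec3_iff:
  "module_hom ((*s) :: 'a::comm_ring_1 \<Rightarrow> 'a ^ 3 \<Rightarrow> 'a ^ 3) ((*s) :: 'a \<Rightarrow> 'a ^ 3 \<Rightarrow> 'a ^ 3) f \<longleftrightarrow>
     (\<forall>x y. f (x + y) = f x + f y) \<and> (\<forall>c x. f (c *s x) = c *s f x)"
  by (simp add: module_hom_iff module_vec3)

lemmas listed_algebra_defs =
  d1_def d2_def d3_def d4_def d5_def d6_def d7_def d8_def d9_def d10_def d11_def d12_def
  d13_def d14_def d15_def d16_def d17_def d18_def d19_def d20_def d21_def d22_def

lemma psi_nth: "psi i j k v w $ l = (if l = k then v $ i * w $ j else 0)"
  by (simp add: psi_def axis_def)

lemma index3_neq:
  "(1::3) \<noteq> 2" "(2::3) \<noteq> 1" "(1::3) \<noteq> 3" "(3::3) \<noteq> 1" "(2::3) \<noteq> 3" "(3::3) \<noteq> 2"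
  by simp_all

lemma vec3_eq_iff: "v = w \<longleftrightarrow> v $ 1 = w $ 1 \<and> v $ 2 = w $ 2 \<and> v $ (3::3) = w $ 3"
  by (simp only: vec_eq_iff forall_3)

lemma assoc_algebraI:
  assumes "\<And>x y z. d (x + y) z = d x z + d y z" "\<And>x y z. d x (y + z) = d x y + d x z"
    "\<And>c x y. d (c *s x) y = c *s d x y" "\<And>c x y. d x (c *s y) = c *s d x y"
    "\<And>x y z. d (d x y) z = d x (d y z)"
  shows "assoc_algebra d"
  using assms by (simp add: assoc_algebra_def bilinear_over_def module_hom_vec3_iff)

lemmas coordinate_simps =
  vec3_eq_iff vector_add_component vector_minus_component vector_smult_component psi_nth
  index3_neq if_True if_False refl simp_thms add_0_left add_0_right

lemma listed_algebras_assoc: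
  assumes "d \<in> listed_algebras"
  shows "assoc_algebra d"
proof -
  have d1: "assoc_algebra d1"
    by (rule assoc_algebraI; simp only: d1_def coordinate_simps; simp add: algebra_simps)
  have d2: "assoc_algebra d2"
    by (rule assoc_algebraI; simp only: d2_def coordinate_simps; simp add: algebra_simps)
  have d3: "assoc_algebra d3"
    by (rule assoc_algebraI; simp only: d3_def coordinate_simps; simp add: algebra_simps)
  have d4: "assoc_algebra d4"
    by (rule assoc_algebraI; simp only: d4_def coordinate_simps; simp add: algebra_simps)
  have d5: "assoc_algebra d5"
    by (rule assoc_algebraI; simp only: d5_def coordinate_simps; simp add: algebra_simps)
  have d6: "assoc_algebra d6"
    by (rule assoc_algebraI; simp only: d6_def coordinate_simps; simp add: algebra_simps)
  have d7: "assoc_algebra d7"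
    by (rule assoc_algebraI; simp only: d7_def coordinate_simps; simp add: algebra_simps)
  have d8: "assoc_algebra d8"
    by (rule assoc_algebraI; simp only: d8_def coordinate_simps; simp add: algebra_simps)
  have d9: "assoc_algebra d9"
    by (rule assoc_algebraI; simp only: d9_def coordinate_simps; simp add: algebra_simps)
  have d10: "assoc_algebra d10"
    by (rule assoc_algebraI; simp only: d10_def coordinate_simps; simp add: algebra_simps)
  have d11: "assoc_algebra d11"
    by (rule assoc_algebraI; simp only: d11_def coordinate_simps; simp add: algebra_simps)
  have d12: "assoc_algebra d12"
    by (rule assoc_algebraI; simp only: d12_def coordinate_simps; simp add: algebra_simps)
  have d13: "assoc_algebra d13"
    by (rule assoc_algebraI; simp only: d13_def coordinate_simps; simp add: algebra_simps)
  have d14: "assoc_algebra d14"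
    by (rule assoc_algebraI; simp only: d14_def coordinate_simps; simp add: algebra_simps)
  have d15: "assoc_algebra d15"
    by (rule assoc_algebraI; simp only: d15_def coordinate_simps; simp add: algebra_simps)
  have d16: "assoc_algebra d16"
    by (rule assoc_algebraI; simp only: d16_def coordinate_simps; simp add: algebra_simps)
  have d17: "assoc_algebra d17"
    by (rule assoc_algebraI; simp only: d17_def coordinate_simps; simp add: algebra_simps)
  have d18: "assoc_algebra d18"
    by (rule assoc_algebraI; simp only: d18_def coordinate_simps; simp add: algebra_simps)
  have d19: "assoc_algebra d19"
    by (rule assoc_algebraI; simp only: d19_def coordinate_simps; simp add: algebra_simps)
  have d20: "assoc_algebra d20"
    by (rule assoc_algebraI; simp only: d20_def coordinate_simps; simp add: algebra_simps)
  have d21: "assoc_algebra d21"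
    by (rule assoc_algebraI; simp only: d21_def coordinate_simps; simp add: algebra_simps)
  have d22: "assoc_algebra (d22 p q)" for p q
    by (rule assoc_algebraI; simp only: d22_def coordinate_simps; simp add: algebra_simps)
  from assms show ?thesis
    unfolding listed_algebras_def
    by (elim UnE insertE emptyE CollectE exE conjE)
       (simp_all only: d1 d2 d3 d4 d5 d6 d7 d8 d9 d10 d11 d12
         d13 d14 d15 d16 d17 d18 d19 d20 d21 d22)
qed

lemma vconst_nth: "vconst v $ k = fps_const (v $ k)"
  by (simp add: vconst_def)

lemma extend_product_nth:
  "extend_product d x y $ k =
     (\<Sum>i\<in>UNIV. \<Sum>j\<in>UNIV. x $ i * y $ j * fps_const (d (axis i 1) (axis j 1) $ k))"
  by (simp only: extend_product_def sum_component vector_smult_component vconst_nth)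

lemma bilinear_over_expand:
  fixes d :: "'a::comm_ring_1 prod3"
  assumes "bilinear_over d"
  shows "d v w $ k = (\<Sum>i\<in>UNIV. \<Sum>j\<in>UNIV. v $ i * w $ j * d (axis i 1) (axis j 1) $ k)"
proof -
  have add: "d (a + b) c = d a c + d b c" "d a (b + c) = d a b + d a c"
    and scale: "d (r *s a) b = r *s d a b" "d a (r *s b) = r *s d a b" for a b c r
    using assms by (simp_all add: bilinear_over_def module_hom_vec3_iff)
  have expand: "u $ 1 *s axis 1 1 + u $ 2 *s axis 2 1 + u $ 3 *s axis 3 1 = u" for u :: "'a ^ 3"
    by (simp add: vec3_eq_iff axis_def)
  have "d v w = d (v $ 1 *s axis 1 1 + v $ 2 *s axis 2 1 + v $ 3 *s axis 3 1)
                  (w $ 1 *s axis 1 1 + w $ 2 *s axis 2 1 + w $ 3 *s axis 3 1)"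
    by (simp only: expand)
  then show ?thesis
    by (simp only: add scale sum_3 vector_add_component vector_smult_component
        distrib_left mult.assoc ac_simps)
qed

lemma extend_product_vconst:
  assumes "bilinear_over d"
  shows "extend_product d (vconst v) (vconst w) = vconst (d v w)"
  unfolding vec_eq_iff
proof
  fix k :: 3
  show "extend_product d (vconst v) (vconst w) $ k = vconst (d v w) $ k"
    unfolding extend_product_nth vconst_nth bilinear_over_expand[OF assms, of v w k] sum_3
    by (simp only: fps_const_add fps_const_mult)
qed

lemma bilinear_over_extend_product: "bilinear_over (extend_product d)"
  unfolding bilinear_over_def module_hom_vec3_iff vec_eq_iff vector_add_component
    vector_smult_component extend_product_nth sum_distrib_left
    sum.distrib[symmetric]
  by (simp only: distrib_left distrib_right ac_simps simp_thms)

end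

theory Submission
  imports Defs
begin

text \<open>
  \<^bold>\<open>Rigidity.\<close> Each of \<open>d7\<close>, \<open>d8\<close>, \<open>d10\<close>, \<open>d11\<close>, \<open>d13\<close>, \<open>d14\<close>, \<open>d20\<close> contains an idempotent \<open>e\<^sub>m\<close>
  for which all basis vectors are simultaneous eigenvectors of left and right multiplication, with
  eigenvalues 0 and 1. Over the complete ring \<open>\<complex>[[t]]\<close> the idempotent lifts to the deformed algebra
  (\<open>lift_idempotent\<close>), and the projections onto its Peirce spaces turn the standard basis into a
  basis \<open>b\<close> of \<open>V[[t]]\<close> with the same eigenvalues and the same reduction modulo \<open>t\<close>
  (\<open>peirce_basis\<close>). Since Peirce spaces multiply like matrix units, almost every product
  \<open>b\<^sub>i b\<^sub>j\<close> is forced to be zero or a multiple of a single basis vector. The few free scalars are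
  settled by associativity: one is annihilated (\<open>d7\<close>), the others either are units that can be scaled
  away or satisfy \<open>c\<^sup>2 = c\<close> and hence are 0 or 1 as determined modulo \<open>t\<close>
  (\<open>normalize_idempotent\<close>, \<open>orthogonal_idempotents\<close>). So \<open>b\<close> has the multiplication table of \<open>d\<close>,
  and expressing vectors in this basis trivializes the deformation (\<open>trivial_deformationI\<close>).

  \<^bold>\<open>Non-rigidity.\<close> Every other algebra of the list except \<open>d21\<close> and \<open>d22\<close> has a basis vector of
  square zero that some polynomial deformation turns into a vector with \<open>e\<^sub>k\<^sup>2 = t\<^sup>m e\<^sub>k\<close>. An equivalence
  with the constant family would produce a vector \<open>u\<close> congruent to \<open>e\<^sub>k\<close> modulo \<open>t\<close> with
  \<open>u\<^sup>2 = t\<^sup>m u\<close> for the undeformed product, and comparing coordinates shows that there is none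
  (\<open>nontrivial_by_square\<close>). The algebras \<open>d21\<close> and \<open>d22\<close> amount to bilinear forms on the span of
  \<open>e\<^sub>1, e\<^sub>2\<close> up to congruence and scaling, and these forms have moduli.

  \<^bold>\<open>Jumps.\<close> In \<open>d8\<close> every product \<open>x y\<close> is a multiple of \<open>x\<close>, in \<open>d20\<close> it is a multiple of \<open>y\<close>.
  This is a closed condition independent of the basis, hence inherited by anything that jumps
  to \<open>d8\<close> or \<open>d20\<close>, and among the listed algebras only \<open>d8\<close>, respectively \<open>d20\<close>, satisfies it.
\<close>


section \<open>Bilinear products over a commutative ring\<close>

lemma bilinear_overD:
  assumes "bilinear_over d"
  shows "d (x + y) z = d x z + d y z" "d x (y + z) = d x y + d x z"
    "d (c *s x) y = c *s d x y" "d x (c *s y) = c *s d x y"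
  using assms by (simp_all add: bilinear_over_def module_hom_vec3_iff)

lemma bilinear_overI:
  assumes "\<And>x y z. d (x + y) z = d x z + d y z" "\<And>x y z. d x (y + z) = d x y + d x z"
    "\<And>c x y. d (c *s x) y = c *s d x y" "\<And>c x y. d x (c *s y) = c *s d x y"
  shows "bilinear_over d"
  using assms by (simp add: bilinear_over_def module_hom_vec3_iff)


section \<open>Reduction modulo the deformation parameter\<close>

lemma vcoeff_nth: "vcoeff x n $ k = fps_nth (x $ k) n"
  by (simp add: vcoeff_def)

lemma vcoeff_vconst: "vcoeff (vconst v) 0 = v"
  by (simp add: vec_eq_iff vcoeff_nth vconst_nth)

lemma vcoeff_add: "vcoeff (x + y) n = vcoeff x n + vcoeff y n"
  by (simp add: vec_eq_iff vcoeff_nth)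

lemma vcoeff_diff: "vcoeff (x - y) n = vcoeff x n - vcoeff y n"
  by (simp add: vec_eq_iff vcoeff_nth)

lemma vcoeff_scale: "vcoeff (c *s x) 0 = fps_nth c 0 *s vcoeff x 0"
  by (simp add: vec_eq_iff vcoeff_nth)

lemma vcoeff_axis: "vcoeff (axis i 1) 0 = axis i 1"
  by (simp add: vec_eq_iff vcoeff_nth axis_def)

lemma vconst_axis: "vconst (axis i 1) = axis i 1"
  by (simp add: vec_eq_iff vconst_nth axis_def)

lemma formal_deformation_assoc: "formal_deformation d D \<Longrightarrow> assoc_algebra D"
  by (simp add: formal_deformation_def)

text \<open>
  A bilinear product is determined by its values on the standard basis, and there the constant
  coefficient is the one of \<open>\<psi>\<^sub>0 = d\<close>. In what follows \<open>d\<close> influences its deformations only through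
  this reduction modulo \<open>t\<close>.
\<close>

lemma formal_deformation_reduce:
  assumes "formal_deformation d D"
  shows "vcoeff (D x y) 0 = d (vcoeff x 0) (vcoeff y 0)"
proof -
  obtain \<psi> where \<psi>: "\<psi> 0 = d" "\<And>n. bilinear_over (\<psi> n)"
    and D: "\<And>v w. D (vconst v) (vconst w) = vseries (\<lambda>n. \<psi> n v w)"
    using assms by (auto simp: formal_deformation_def)
  have bil: "bilinear_over D" "bilinear_over d"
    using assms \<psi>(2)[of 0] \<psi>(1) by (simp_all add: formal_deformation_def assoc_algebra_def)
  have basis: "fps_nth (D (axis i 1) (axis j 1) $ k) 0 = d (axis i 1) (axis j 1) $ k" for i j k
    using D[of "axis i 1" "axis j 1"] \<psi>(1) by (simp add: vconst_axis vseries_def)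
  show ?thesis
    by (simp add: vec_eq_iff vcoeff_nth bilinear_over_expand[OF bil(1), of x y]
        bilinear_over_expand[OF bil(2), of "vcoeff x 0" "vcoeff y 0"] fps_sum_nth basis)
qed

text \<open>
  The maps \<open>\<psi>\<^sub>n\<close> can be read off the coefficients of a bilinear product on \<open>V[[t]]\<close>, so only the
  constant term has to be compared with \<open>d\<close>.
\<close>

lemma formal_deformationI:
  assumes "assoc_algebra D" "\<And>v w. vcoeff (D (vconst v) (vconst w)) 0 = d v w"
  shows "formal_deformation d D"
  unfolding formal_deformation_def
proof (intro conjI exI allI)
  let ?\<psi> = "\<lambda>n v w. vcoeff (D (vconst v) (vconst w)) n"
  have bil: "bilinear_over D"
    using assms(1) by (simp add: assoc_algebra_def)
  have vc: "vconst (v + w) = vconst v + vconst w"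
    "vconst (c *s v) = fps_const c *s vconst v" for v w c
    by (simp_all add: vec_eq_iff vconst_nth)
  show "?\<psi> 0 = d" using assms(2) by (intro ext)
  show "bilinear_over (?\<psi> n)" for n
    by (rule bilinear_overI)
       (simp_all add: vc bilinear_overD[OF bil], simp_all add: vec_eq_iff vcoeff_nth)
  show "D (vconst v) (vconst w) = vseries (\<lambda>n. ?\<psi> n v w)" for v w
    by (simp add: vec_eq_iff vseries_def vcoeff_nth fps_eq_iff)
qed (fact assms(1))


section \<open>Algebras with nontrivial deformations\<close>

lemma trivial_deformationE:
  assumes "no_nontrivial_deformations d" "assoc_algebra D"
    and "\<And>v w. vcoeff (D (vconst v) (vconst w)) 0 = d v w"
  obtains \<Phi> where "\<forall>c x. \<Phi> (c *s x) = c *s \<Phi> x"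
    "\<forall>x y. \<Phi> (D x y) = extend_product d (\<Phi> x) (\<Phi> y)" "\<forall>x. vcoeff (\<Phi> x) 0 = vcoeff x 0"
proof -
  have "trivial_deformation d D"
    using assms(1) formal_deformationI[OF assms(2,3)] by (simp add: no_nontrivial_deformations_def)
  then show thesis
    using that unfolding trivial_deformation_def algebra_iso_def module_hom_vec3_iff by blast
qed

text \<open>
  The square of the \<open>k\<close>-th basis vector serves as the obstruction: an equivalence maps this
  vector to some \<open>u\<close> with the same constant term that satisfies the same equation for the undeformed
  product.
\<close>

lemma nontrivial_by_square:
  assumes "assoc_algebra D" and "\<And>v w. vcoeff (D (vconst v) (vconst w)) 0 = d v w"
    and sq: "D (axis k 1) (axis k 1) = c *s axis k 1"
    and no: "\<And>u. fps_nth (u $ k) 0 = 1 \<Longrightarrow> extend_product d u u = c *s u \<Longrightarrow> False"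
  shows "\<not> no_nontrivial_deformations d"
proof
  assume "no_nontrivial_deformations d"
  from this assms(1,2) obtain \<Phi> where \<Phi>: "\<forall>c x. \<Phi> (c *s x) = c *s \<Phi> x"
    "\<forall>x y. \<Phi> (D x y) = extend_product d (\<Phi> x) (\<Phi> y)" "\<forall>x. vcoeff (\<Phi> x) 0 = vcoeff x 0"
    by (rule trivial_deformationE)
  let ?u = "\<Phi> (axis k 1)"
  have "fps_nth (?u $ k) 0 = 1"
    using \<Phi>(3)[rule_format, of "axis k 1"] by (simp add: vec_eq_iff vcoeff_nth axis_def)
  moreover have "extend_product d ?u ?u = c *s ?u"
    using \<Phi>(1,2) sq by metis
  ultimately show False by (rule no)
qed

lemmas component_simps = vec3_eq_iff vector_3 vector_add_component vector_smult_component

lemmas extend_simps = vec3_eq_iff extend_product_nth vector_smult_component vector_add_component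
  vector_minus_component sum_3 psi_nth axis_nth index3_neq

text \<open>
  In \<open>d1\<close> and in \<open>d3\<close> to \<open>d6\<close> the vector \<open>e\<^sub>2\<close> spans a direct factor with zero product, which is
  turned into the base field with its product multiplied by \<open>t\<close>. In \<open>d15\<close> the same is done with \<open>e\<^sub>3\<close>.
\<close>

lemma d1_nonrigid: "\<not> no_nontrivial_deformations d1"
proof (rule nontrivial_by_square)
  let ?D = "(\<lambda>x y. vector [x$1 * y$1, fps_X * (x$2 * y$2), 0]) :: complex fps prod3"
  show "assoc_algebra ?D"
    by (rule assoc_algebraI; simp add: component_simps algebra_simps)
  show "vcoeff (?D (vconst v) (vconst w)) 0 = d1 v w" for v w
    by (simp add: vec3_eq_iff vector_3 vcoeff_nth vconst_nth d1_def psi_nth)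
  show "?D (axis 2 1) (axis 2 1) = fps_X *s axis 2 1"
    by (simp add: vec3_eq_iff vector_3 axis_def)
  show False if "fps_nth (u $ 2) 0 = 1" "extend_product d1 u u = fps_X *s u" for u
    using that by (fastforce simp: extend_simps d1_def axis_def)
qed

text \<open>
  For \<open>x = e\<^sub>2\<close>, the factor with basis \<open>x, x\<^sup>2\<close> is given by the relation \<open>x\<^sup>3 = 0\<close>, which is deformed
  to \<open>x\<^sup>3 = t x\<^sup>2\<close>.
\<close>

lemma d2_nonrigid: "\<not> no_nontrivial_deformations d2"
proof (rule nontrivial_by_square)
  let ?D = "(\<lambda>x y. vector [x$1 * y$1, 0, x$2 * y$2
        + fps_X * (x$2 * y$3 + x$3 * y$2) + fps_X^2 * (x$3 * y$3)])
      :: complex fps prod3"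
  show "assoc_algebra ?D"
    by (rule assoc_algebraI; simp add: component_simps algebra_simps eval_nat_numeral)
  show "vcoeff (?D (vconst v) (vconst w)) 0 = d2 v w" for v w
    by (simp add: vec3_eq_iff vector_3 vcoeff_nth vconst_nth d2_def psi_nth)
  show "?D (axis 3 1) (axis 3 1) = fps_X^2 *s axis 3 1"
    by (simp add: vec3_eq_iff vector_3 axis_def)
  show False if "fps_nth (u $ 3) 0 = 1" "extend_product d2 u u = fps_X^2 *s u" for u
    using that by (fastforce simp: extend_simps d2_def axis_def)
qed

lemma d3_nonrigid: "\<not> no_nontrivial_deformations d3"
proof (rule nontrivial_by_square)
  let ?D = "(\<lambda>x y. vector [x$1 * y$1, fps_X * (x$2 * y$2), x$1 * y$3]) :: complex fps prod3"
  show "assoc_algebra ?D"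
    by (rule assoc_algebraI; simp add: component_simps algebra_simps)
  show "vcoeff (?D (vconst v) (vconst w)) 0 = d3 v w" for v w
    by (simp add: vec3_eq_iff vector_3 vcoeff_nth vconst_nth d3_def psi_nth)
  show "?D (axis 2 1) (axis 2 1) = fps_X *s axis 2 1"
    by (simp add: vec3_eq_iff vector_3 axis_def)
  show False if "fps_nth (u $ 2) 0 = 1" "extend_product d3 u u = fps_X *s u" for u
    using that by (fastforce simp: extend_simps d3_def axis_def)
qed

lemma d4_nonrigid: "\<not> no_nontrivial_deformations d4"
proof (rule nontrivial_by_square)
  let ?D = "(\<lambda>x y. vector [x$1 * y$1, fps_X * (x$2 * y$2), x$3 * y$1]) :: complex fps prod3"
  show "assoc_algebra ?D"
    by (rule assoc_algebraI; simp add: component_simps algebra_simps)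
  show "vcoeff (?D (vconst v) (vconst w)) 0 = d4 v w" for v w
    by (simp add: vec3_eq_iff vector_3 vcoeff_nth vconst_nth d4_def psi_nth)
  show "?D (axis 2 1) (axis 2 1) = fps_X *s axis 2 1"
    by (simp add: vec3_eq_iff vector_3 axis_def)
  show False if "fps_nth (u $ 2) 0 = 1" "extend_product d4 u u = fps_X *s u" for u
    using that by (fastforce simp: extend_simps d4_def axis_def)
qed

lemma d5_nonrigid: "\<not> no_nontrivial_deformations d5"
proof (rule nontrivial_by_square)
  let ?D = "(\<lambda>x y. vector [x$1 * y$1, fps_X * (x$2 * y$2), x$1 * y$3 + x$3 * y$1])
      :: complex fps prod3"
  show "assoc_algebra ?D"
    by (rule assoc_algebraI; simp add: component_simps algebra_simps)
  show "vcoeff (?D (vconst v) (vconst w)) 0 = d5 v w" for v w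
    by (simp add: vec3_eq_iff vector_3 vcoeff_nth vconst_nth d5_def psi_nth)
  show "?D (axis 2 1) (axis 2 1) = fps_X *s axis 2 1"
    by (simp add: vec3_eq_iff vector_3 axis_def)
  show False if "fps_nth (u $ 2) 0 = 1" "extend_product d5 u u = fps_X *s u" for u
    using that by (fastforce simp: extend_simps d5_def axis_def)
qed

lemma d6_nonrigid: "\<not> no_nontrivial_deformations d6"
proof (rule nontrivial_by_square)
  let ?D = "(\<lambda>x y. vector [x$1 * y$1, fps_X * (x$2 * y$2), x$3 * y$3]) :: complex fps prod3"
  show "assoc_algebra ?D"
    by (rule assoc_algebraI; simp add: component_simps algebra_simps)
  show "vcoeff (?D (vconst v) (vconst w)) 0 = d6 v w" for v w
    by (simp add: vec3_eq_iff vector_3 vcoeff_nth vconst_nth d6_def psi_nth)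
  show "?D (axis 2 1) (axis 2 1) = fps_X *s axis 2 1"
    by (simp add: vec3_eq_iff vector_3 axis_def)
  show False if "fps_nth (u $ 2) 0 = 1" "extend_product d6 u u = fps_X *s u" for u
    using that by (fastforce simp: extend_simps d6_def axis_def)
qed

text \<open>
  In \<open>d9\<close> and \<open>d12\<close> the vector \<open>x = e\<^sub>3\<close> spans a copy of \<open>\<complex>[x]/(x\<^sup>2)\<close> together with its unit \<open>e\<^sub>1\<close>,
  respectively \<open>e\<^sub>2\<close>; the relation is deformed to \<open>x\<^sup>2 = t x\<close>.
\<close>

lemma d9_nonrigid: "\<not> no_nontrivial_deformations d9"
proof (rule nontrivial_by_square)
  let ?D = "(\<lambda>x y. vector [x$1 * y$1, x$2 * y$1, x$1 * y$3 + x$3 * y$1 + fps_X * (x$3 * y$3)])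
      :: complex fps prod3"
  show "assoc_algebra ?D"
    by (rule assoc_algebraI; simp add: component_simps algebra_simps)
  show "vcoeff (?D (vconst v) (vconst w)) 0 = d9 v w" for v w
    by (simp add: vec3_eq_iff vector_3 vcoeff_nth vconst_nth d9_def psi_nth)
  show "?D (axis 3 1) (axis 3 1) = fps_X *s axis 3 1"
    by (simp add: vec3_eq_iff vector_3 axis_def)
  show False if "fps_nth (u $ 3) 0 = 1" "extend_product d9 u u = fps_X *s u" for u
    using that by (fastforce simp: extend_simps d9_def axis_def)
qed

lemma d12_nonrigid: "\<not> no_nontrivial_deformations d12"
proof (rule nontrivial_by_square)
  let ?D = "(\<lambda>x y. vector [x$1 * y$1, x$2 * y$2, x$2 * y$3 + x$3 * y$2 + fps_X * (x$3 * y$3)])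
      :: complex fps prod3"
  show "assoc_algebra ?D"
    by (rule assoc_algebraI; simp add: component_simps algebra_simps)
  show "vcoeff (?D (vconst v) (vconst w)) 0 = d12 v w" for v w
    by (simp add: vec3_eq_iff vector_3 vcoeff_nth vconst_nth d12_def psi_nth)
  show "?D (axis 3 1) (axis 3 1) = fps_X *s axis 3 1"
    by (simp add: vec3_eq_iff vector_3 axis_def)
  show False if "fps_nth (u $ 3) 0 = 1" "extend_product d12 u u = fps_X *s u" for u
    using that by (fastforce simp: extend_simps d12_def axis_def)
qed

lemma d15_nonrigid: "\<not> no_nontrivial_deformations d15"
proof (rule nontrivial_by_square)
  let ?D = "(\<lambda>x y. vector [0, x$1 * y$1, fps_X * (x$3 * y$3)]) :: complex fps prod3"
  show "assoc_algebra ?D"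
    by (rule assoc_algebraI; simp add: component_simps algebra_simps)
  show "vcoeff (?D (vconst v) (vconst w)) 0 = d15 v w" for v w
    by (simp add: vec3_eq_iff vector_3 vcoeff_nth vconst_nth d15_def psi_nth)
  show "?D (axis 3 1) (axis 3 1) = fps_X *s axis 3 1"
    by (simp add: vec3_eq_iff vector_3 axis_def)
  show False if "fps_nth (u $ 3) 0 = 1" "extend_product d15 u u = fps_X *s u" for u
    using that by (fastforce simp: extend_simps d15_def axis_def)
qed

text \<open>
  The basis is \<open>x, x\<^sup>2, x\<^sup>3\<close> for \<open>x = e\<^sub>1\<close>, and \<open>x\<^sup>4 = 0\<close> is deformed to \<open>x\<^sup>4 = t x\<^sup>3\<close>.
\<close>

lemma d16_nonrigid: "\<not> no_nontrivial_deformations d16"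
proof (rule nontrivial_by_square)
  let ?D = "(\<lambda>x y. vector [0, x$1 * y$1, x$1 * y$2 + x$2 * y$1
      + fps_X * (x$1 * y$3 + x$2 * y$2 + x$3 * y$1)
      + fps_X^2 * (x$2 * y$3 + x$3 * y$2) + fps_X^3 * (x$3 * y$3)]) :: complex fps prod3"
  show "assoc_algebra ?D"
    by (rule assoc_algebraI; simp add: component_simps algebra_simps eval_nat_numeral)
  show "vcoeff (?D (vconst v) (vconst w)) 0 = d16 v w" for v w
    by (simp add: vec3_eq_iff vector_3 vcoeff_nth vconst_nth d16_def psi_nth)
  show "?D (axis 3 1) (axis 3 1) = fps_X^3 *s axis 3 1"
    by (simp add: vec3_eq_iff vector_3 axis_def)
  show False if "fps_nth (u $ 3) 0 = 1" "extend_product d16 u u = fps_X^3 *s u" for u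
    using that by (fastforce simp: extend_simps d16_def axis_def)
qed

text \<open>
  In \<open>d17\<close> and \<open>d18\<close> the span of \<open>e\<^sub>1, e\<^sub>2\<close> is \<open>\<complex>[x]/(x\<^sup>2)\<close> with \<open>x = e\<^sub>2\<close> and unit \<open>e\<^sub>1 - e\<^sub>2\<close>. The unit
  is kept and the relation is deformed to \<open>x\<^sup>2 = t x\<close>, which changes all products of \<open>e\<^sub>1\<close> and \<open>e\<^sub>2\<close>.
\<close>

lemma d17_nonrigid: "\<not> no_nontrivial_deformations d17"
proof (rule nontrivial_by_square)
  let ?D = "(\<lambda>x y. vector [x$1 * y$1, x$1 * y$1 + x$1 * y$2 + x$2 * y$1
      + fps_X * (x$1 * y$1 + x$1 * y$2 + x$2 * y$1 + x$2 * y$2), x$1 * y$3]) :: complex fps prod3"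
  show "assoc_algebra ?D"
    by (rule assoc_algebraI; simp add: component_simps algebra_simps)
  show "vcoeff (?D (vconst v) (vconst w)) 0 = d17 v w" for v w
    by (simp add: vec3_eq_iff vector_3 vcoeff_nth vconst_nth d17_def psi_nth)
  show "?D (axis 2 1) (axis 2 1) = fps_X *s axis 2 1"
    by (simp add: vec3_eq_iff vector_3 axis_def)
  show False if u: "fps_nth (u $ 2) 0 = 1" "extend_product d17 u u = fps_X *s u" for u
  proof -
    have u1: "u $ 1 = 0 \<or> u $ 1 = fps_X" and "fps_X * (u $ 2 + u $ 1) = 0"
      using u(2) by (auto simp: extend_simps d17_def axis_def algebra_simps)
    then have "u $ 2 = - u $ 1" by (simp add: eq_neg_iff_add_eq_0)
    with u1 u(1) show False by auto
  qed
qed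

lemma d18_nonrigid: "\<not> no_nontrivial_deformations d18"
proof (rule nontrivial_by_square)
  let ?D = "(\<lambda>x y. vector [x$1 * y$1, x$1 * y$1 + x$1 * y$2 + x$2 * y$1
      + fps_X * (x$1 * y$1 + x$1 * y$2 + x$2 * y$1 + x$2 * y$2), x$1 * y$3 + x$3 * y$1])
      :: complex fps prod3"
  show "assoc_algebra ?D"
    by (rule assoc_algebraI; simp add: component_simps algebra_simps)
  show "vcoeff (?D (vconst v) (vconst w)) 0 = d18 v w" for v w
    by (simp add: vec3_eq_iff vector_3 vcoeff_nth vconst_nth d18_def psi_nth)
  show "?D (axis 2 1) (axis 2 1) = fps_X *s axis 2 1"
    by (simp add: vec3_eq_iff vector_3 axis_def)
  show False if u: "fps_nth (u $ 2) 0 = 1" "extend_product d18 u u = fps_X *s u" for u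
  proof -
    have u1: "u $ 1 = 0 \<or> u $ 1 = fps_X" and "fps_X * (u $ 2 + u $ 1) = 0"
      using u(2) by (auto simp: extend_simps d18_def axis_def algebra_simps)
    then have "u $ 2 = - u $ 1" by (simp add: eq_neg_iff_add_eq_0)
    with u1 u(1) show False by auto
  qed
qed

text \<open>
  This is \<open>\<complex>[x]/(x\<^sup>3)\<close> with unit \<open>e\<^sub>3\<close> and \<open>x = e\<^sub>1\<close>; the relation is deformed to \<open>x\<^sup>3 = t x\<^sup>2\<close>.
\<close>

lemma d19_nonrigid: "\<not> no_nontrivial_deformations d19"
proof (rule nontrivial_by_square)
  let ?D = "(\<lambda>x y. vector [x$1 * y$3 + x$3 * y$1, x$1 * y$1 + x$2 * y$3 + x$3 * y$2
      + fps_X * (x$1 * y$2 + x$2 * y$1)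
      + fps_X^2 * (x$2 * y$2), x$3 * y$3]) :: complex fps prod3"
  show "assoc_algebra ?D"
    by (rule assoc_algebraI; simp add: component_simps algebra_simps eval_nat_numeral)
  show "vcoeff (?D (vconst v) (vconst w)) 0 = d19 v w" for v w
    by (simp add: vec3_eq_iff vector_3 vcoeff_nth vconst_nth d19_def psi_nth)
  show "?D (axis 2 1) (axis 2 1) = fps_X^2 *s axis 2 1"
    by (simp add: vec3_eq_iff vector_3 axis_def)
  show False if "fps_nth (u $ 2) 0 = 1" "extend_product d19 u u = fps_X^2 *s u" for u
    using that by (fastforce simp: extend_simps d19_def axis_def)
qed

text \<open>
  All products lie on the line of \<open>e\<^sub>3\<close>, so the algebra is the bilinear form \<open>a u\<^sub>1 v\<^sub>2 + b u\<^sub>2 v\<^sub>1\<close>. Moving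
  \<open>(a:b)\<close> along the projective line is a nontrivial deformation: an equivalence would carry the moved
  form, up to a unit \<open>w\<close>, back to the original one by a substitution \<open>e\<^sub>1 \<mapsto> p\<close>, \<open>e\<^sub>2 \<mapsto> q\<close>.
\<close>

lemma d22_nonrigid:
  assumes "(a, b) \<noteq> (0, 0)"
  shows "\<not> no_nontrivial_deformations (d22 a b)"
proof
  \<comment> \<open>The direction of the motion, transversal to the line through \<open>(a, b)\<close>.\<close>
  obtain \<alpha> \<beta> :: complex where ne: "\<alpha> * b \<noteq> \<beta> * a"
  proof (cases "b = 0")
    case True
    with assms show ?thesis using that[of 0 1] by auto
  next
    case False
    then show ?thesis using that[of 1 0] by auto
  qed
  let ?a = "fps_const a" and ?b = "fps_const b"
  let ?a' = "fps_const a + fps_const \<alpha> * fps_X" and ?b' = "fps_const b + fps_const \<beta> * fps_X"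
  let ?D = "(\<lambda>x y. vector [0, 0, ?a' * (x$1 * y$2) + ?b' * (x$2 * y$1)]) :: complex fps prod3"
  assume rigid: "no_nontrivial_deformations (d22 a b)"
  have assoc: "assoc_algebra ?D"
    by (rule assoc_algebraI; simp add: component_simps algebra_simps)
  have "vcoeff (?D (vconst v) (vconst w)) 0 = d22 a b v w" for v w
    by (simp add: vec3_eq_iff vector_3 vcoeff_nth vconst_nth d22_def psi_nth)
  with rigid assoc obtain \<Phi> where \<Phi>: "\<forall>c x. \<Phi> (c *s x) = c *s \<Phi> x"
    "\<forall>x y. \<Phi> (?D x y) = extend_product (d22 a b) (\<Phi> x) (\<Phi> y)"
    "\<forall>x. vcoeff (\<Phi> x) 0 = vcoeff x 0"
    by (rule trivial_deformationE)
  define p q w where "p = \<Phi> (axis 1 1)" and "q = \<Phi> (axis 2 1)" and "w = \<Phi> (axis 3 1) $ 3"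
  have const: "fps_nth (p $ 1) 0 = 1" "fps_nth (q $ 2) 0 = 1" "fps_nth w 0 = 1"
    using \<Phi>(3)[rule_format, of "axis 1 1"] \<Phi>(3)[rule_format, of "axis 2 1"]
      \<Phi>(3)[rule_format, of "axis 3 1"]
    by (simp_all add: p_def q_def w_def vec_eq_iff vcoeff_nth axis_def)
  have D: "?D (axis 1 1) (axis 1 1) = 0 *s axis 3 1" "?D (axis 1 1) (axis 2 1) = ?a' *s axis 3 1"
    "?D (axis 2 1) (axis 1 1) = ?b' *s axis 3 1"
    by (simp_all add: vec3_eq_iff vector_3 axis_def)
  have "extend_product (d22 a b) x y $ 3 = ?a * (x$1 * y$2) + ?b * (x$2 * y$1)" for x y
    by (simp add: extend_simps d22_def axis_def mult.commute)
  then have form: "\<Phi> (?D x y) $ 3 = ?a * (\<Phi> x $ 1 * \<Phi> y $ 2) + ?b * (\<Phi> x $ 2 * \<Phi> y $ 1)" for x y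
    by (simp only: \<Phi>(2)[rule_format])
  have 11: "0 * w = ?a * (p$1 * p$2) + ?b * (p$2 * p$1)"
    using form[of "axis 1 1" "axis 1 1"] unfolding D \<Phi>(1)[rule_format] vector_smult_component
    by (simp only: p_def w_def)
  have 12: "?a' * w = ?a * (p$1 * q$2) + ?b * (p$2 * q$1)"
    using form[of "axis 1 1" "axis 2 1"] unfolding D \<Phi>(1)[rule_format] vector_smult_component
    by (simp only: p_def q_def w_def)
  have 21: "?b' * w = ?a * (q$1 * p$2) + ?b * (q$2 * p$1)"
    using form[of "axis 2 1" "axis 1 1"] unfolding D \<Phi>(1)[rule_format] vector_smult_component
    by (simp only: p_def q_def w_def)
  have ne0: "w \<noteq> 0" "p $ 1 \<noteq> 0" using const by auto
  show False
  proof (cases "a + b = 0")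
    \<comment> \<open>For an alternating form the substitution preserves antisymmetry.\<close>
    case True
    then have b: "b = - a" by (simp add: eq_neg_iff_add_eq_0 add.commute)
    have "fps_const (\<alpha> + \<beta>) * (fps_X * w) = ?a' * w + ?b' * w"
      unfolding b by (simp add: algebra_simps flip: fps_const_add fps_const_neg)
    also have "\<dots> = 0"
      unfolding 12 21 unfolding b by (simp add: algebra_simps flip: fps_const_neg)
    finally have "\<alpha> + \<beta> = 0" using ne0 by simp
    then show False using ne b by (simp add: add_eq_0_iff)
  next
    \<comment> \<open>Otherwise \<open>p\<close> isotropic forces \<open>p\<^sub>2 = 0\<close>, and the two mixed values stay proportional to \<open>a, b\<close>.\<close>
    case False
    have "fps_const (a + b) * (p$1 * p$2) = 0"
      using 11 by (simp add: algebra_simps flip: fps_const_add)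
    then have p2: "p $ 2 = 0"
      using False ne0 by simp
    have "fps_const (\<alpha> * b - \<beta> * a) * (fps_X * w) = ?b * (?a' * w) - ?a * (?b' * w)"
      by (simp add: algebra_simps flip: fps_const_sub fps_const_mult)
    also have "\<dots> = 0"
      unfolding 12 21 p2 by (simp add: algebra_simps)
    finally show False using ne ne0 by simp
  qed
qed

text \<open>
  Here the form is \<open>u\<^sub>1 v\<^sub>1 + u\<^sub>1 v\<^sub>2 - u\<^sub>2 v\<^sub>1\<close>, whose symmetric part is degenerate with kernel spanned by
  \<open>e\<^sub>2\<close>. Adding \<open>t u\<^sub>2 v\<^sub>2\<close> makes the symmetric part nondegenerate, which no substitution can do.
\<close>

lemma d21_nonrigid: "\<not> no_nontrivial_deformations d21"
proof
  let ?D = "(\<lambda>x y. vector [0, 0, x$1 * y$1 + x$1 * y$2 - x$2 * y$1 + fps_X * (x$2 * y$2)])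
      :: complex fps prod3"
  assume rigid: "no_nontrivial_deformations d21"
  have assoc: "assoc_algebra ?D"
    by (rule assoc_algebraI; simp add: component_simps algebra_simps)
  have "vcoeff (?D (vconst v) (vconst w)) 0 = d21 v w" for v w
    by (simp add: vec3_eq_iff vector_3 vcoeff_nth vconst_nth d21_def psi_nth)
  with rigid assoc obtain \<Phi> where \<Phi>: "\<forall>c x. \<Phi> (c *s x) = c *s \<Phi> x"
    "\<forall>x y. \<Phi> (?D x y) = extend_product d21 (\<Phi> x) (\<Phi> y)"
    "\<forall>x. vcoeff (\<Phi> x) 0 = vcoeff x 0"
    by (rule trivial_deformationE)
  define p q w where "p = \<Phi> (axis 1 1)" and "q = \<Phi> (axis 2 1)" and "w = \<Phi> (axis 3 1) $ 3"
  have const: "fps_nth (p $ 1) 0 = 1" "fps_nth w 0 = 1"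
    using \<Phi>(3)[rule_format, of "axis 1 1"] \<Phi>(3)[rule_format, of "axis 3 1"]
    by (simp_all add: p_def w_def vec_eq_iff vcoeff_nth axis_def)
  have D: "?D (axis 2 1) (axis 2 1) = fps_X *s axis 3 1" "?D (axis 1 1) (axis 2 1) = 1 *s axis 3 1"
    "?D (axis 2 1) (axis 1 1) = (-1) *s axis 3 1"
    by (simp_all add: vec3_eq_iff vector_3 axis_def)
  have minus1: "fps_const (-1) = (-1 :: complex fps)"
    by (simp flip: fps_const_neg)
  have "extend_product d21 x y $ 3 = x$1 * y$1 + x$1 * y$2 - x$2 * y$1" for x y
    by (simp add: extend_simps d21_def axis_def minus1)
  then have form:
    "\<Phi> (?D x y) $ 3 = \<Phi> x $ 1 * \<Phi> y $ 1 + \<Phi> x $ 1 * \<Phi> y $ 2 - \<Phi> x $ 2 * \<Phi> y $ 1" for x y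
    by (simp only: \<Phi>(2)[rule_format])
  have 22: "fps_X * w = q$1 * q$1 + q$1 * q$2 - q$2 * q$1"
    using form[of "axis 2 1" "axis 2 1"] unfolding D \<Phi>(1)[rule_format] vector_smult_component
    by (simp only: q_def w_def)
  have 12: "1 * w = p$1 * q$1 + p$1 * q$2 - p$2 * q$1"
    using form[of "axis 1 1" "axis 2 1"] unfolding D \<Phi>(1)[rule_format] vector_smult_component
    by (simp only: p_def q_def w_def)
  have 21: "(-1) * w = q$1 * p$1 + q$1 * p$2 - q$2 * p$1"
    using form[of "axis 2 1" "axis 1 1"] unfolding D \<Phi>(1)[rule_format] vector_smult_component
    by (simp only: p_def q_def w_def)
  have "2 * (p$1 * q$1) = 1 * w + (-1) * w"
    unfolding 12 21 by (simp add: algebra_simps)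
  then have "q $ 1 = 0" using const by auto
  with 22 const show False by auto
qed


section \<open>Lifting idempotents\<close>

lemma assoc_algebraD:
  assumes "assoc_algebra D"
  shows "D (x + y) z = D x z + D y z" "D x (y + z) = D x y + D x z"
    "D (x - y) z = D x z - D y z" "D x (y - z) = D x y - D x z"
    "D (c *s x) y = c *s D x y" "D x (c *s y) = c *s D x y"
    "D 0 y = 0" "D x 0 = 0" "D (D x y) z = D x (D y z)"
proof -
  have bil: "bilinear_over D" and assoc: "D (D x y) z = D x (D y z)"
    using assms by (simp_all add: assoc_algebra_def)
  show "D (x + y) z = D x z + D y z" "D x (y + z) = D x y + D x z"
    "D (c *s x) y = c *s D x y" "D x (c *s y) = c *s D x y" "D (D x y) z = D x (D y z)"
    by (simp_all add: bilinear_overD[OF bil] assoc)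
  show "D (x - y) z = D x z - D y z" "D x (y - z) = D x y - D x z"
    using bilinear_overD(1)[OF bil, of "x - y" y z] bilinear_overD(2)[OF bil, of x "y - z" z]
    by (simp_all add: algebra_simps)
  show "D 0 y = 0" "D x 0 = 0"
    using bilinear_overD(3)[OF bil, of 0 0 y] bilinear_overD(4)[OF bil, of x 0 0] by simp_all
qed

lemma X_power_multiple_iff: "(\<exists>s. x = fps_X ^ n *s s) \<longleftrightarrow> (\<forall>m<n. vcoeff x m = 0)"
proof
  assume "\<forall>m<n. vcoeff x m = 0"
  then have "x = fps_X ^ n *s (\<chi> k. fps_shift n (x $ k))"
    by (auto simp: vec_eq_iff vcoeff_nth fps_eq_iff fps_X_power_mult_nth)
  then show "\<exists>s. x = fps_X ^ n *s s" by blast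
qed (auto simp: vec_eq_iff vcoeff_nth fps_X_power_mult_nth)

text \<open>
  The approximations agree to ever higher order, so the limit is the diagonal series whose
  \<open>n\<close>-th coefficient is taken from \<open>a n\<close>.
\<close>

lemma X_adic_limit:
  assumes "\<And>n. \<exists>s. a (Suc n) - a n = fps_X ^ Suc n *s s"
  obtains e :: "complex fps ^ 3" where "\<And>n. \<exists>s. e - a n = fps_X ^ Suc n *s s"
proof -
  have "vcoeff (a (Suc n)) k = vcoeff (a n) k" if "k \<le> n" for k n
    using assms[of n] that unfolding X_power_multiple_iff by (simp add: vcoeff_diff)
  then have stable: "vcoeff (a (k + m)) k = vcoeff (a k) k" for k m
    by (induction m) auto
  have "\<exists>s. vseries (\<lambda>n. vcoeff (a n) n) - a n = fps_X ^ Suc n *s s" for n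
    unfolding X_power_multiple_iff
  proof (intro allI impI)
    fix m assume "m < Suc n"
    then have "vcoeff (a n) m = vcoeff (a m) m"
      using stable[of m "n - m"] by simp
    then show "vcoeff (vseries (\<lambda>n. vcoeff (a n) n) - a n) m = 0"
      by (simp add: vec_eq_iff vcoeff_nth vseries_def)
  qed
  then show thesis by (rule that)
qed

text \<open>
  The Newton step \<open>3 a\<^sup>2 - 2 a\<^sup>3\<close> for the equation \<open>a\<^sup>2 = a\<close> squares the error:
  with \<open>q = a\<^sup>2 - a\<close> the new value \<open>a'\<close> satisfies \<open>a' - a = q - 2 a q\<close> and
  \<open>a'\<^sup>2 - a' = 4 q\<^sup>3 - 3 q\<^sup>2\<close>, which makes sense without a unit.
\<close>

lemma idempotent_newton_step:
  fixes D :: "'a::comm_ring_1 prod3"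
  assumes "assoc_algebra D" and r: "D a a - a = c *s s"
  defines "a' \<equiv> 3 *s D a a - 2 *s D a (D a a)"
  shows "\<exists>s. a' - a = c *s s" "\<exists>s. D a' a' - a' = c ^ 2 *s s"
proof -
  note [simp] = assoc_algebraD[OF assms(1)]
  define q where "q = D a a - a"
  have q: "q = c *s s" by (simp add: q_def r)
  have "a' - a = q - 2 *s D a q"
    by (simp add: a'_def q_def vec_eq_iff algebra_simps)
  also have "\<dots> = c *s (s - 2 *s D a s)"
    by (simp add: q vec_eq_iff algebra_simps)
  finally show "\<exists>s. a' - a = c *s s" by blast
  have "D a' a' - a' = 4 *s D q (D q q) - 3 *s D q q"
    by (simp only: a'_def q_def assoc_algebraD[OF assms(1)])
       (simp add: vec_eq_iff algebra_simps)
  also have "\<dots> = c ^ 2 *s (4 *s (c *s D s (D s s)) - 3 *s D s s)"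
    by (simp add: q vec_eq_iff algebra_simps power2_eq_square)
  finally show "\<exists>s. D a' a' - a' = c ^ 2 *s s" by blast
qed

text \<open>
  Newton iteration started at the constant vector converges \<open>t\<close>-adically. Only one additional
  order per step is recorded, although each step doubles the precision.
\<close>

lemma lift_idempotent:
  assumes def: "formal_deformation d D" and idem: "d v v = v"
  obtains f where "D f f = f" "vcoeff f 0 = v"
proof -
  have assoc: "assoc_algebra D" using def by (rule formal_deformation_assoc)
  note [simp] = assoc_algebraD[OF assoc]
  define a where "a n = ((\<lambda>a. 3 *s D a a - 2 *s D a (D a a)) ^^ n) (vconst v)" for n
  have a_Suc: "a (Suc n) = 3 *s D (a n) (a n) - 2 *s D (a n) (D (a n) (a n))" for n
    by (simp add: a_def)
  have approx: "\<exists>s. D (a n) (a n) - a n = fps_X ^ Suc n *s s" for n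
  proof (induction n)
    case 0
    then show ?case
      unfolding X_power_multiple_iff
      by (simp add: a_def vcoeff_diff formal_deformation_reduce[OF def] vcoeff_vconst idem)
  next
    case (Suc n)
    then obtain s where "D (a n) (a n) - a n = fps_X ^ Suc n *s s" ..
    from idempotent_newton_step(2)[OF assoc this] obtain s'
      where "D (a (Suc n)) (a (Suc n)) - a (Suc n) = (fps_X ^ Suc n) ^ 2 *s s'"
      unfolding a_Suc[symmetric] ..
    also have "(fps_X ^ Suc n) ^ 2 = fps_X ^ Suc (Suc n) * (fps_X ^ n :: complex fps)"
      by (simp only: power2_eq_square power_add[symmetric] add_Suc add_Suc_right)
    finally show ?case
      by (metis vector_smult_assoc)
  qed
  have "\<exists>s. a (Suc n) - a n = fps_X ^ Suc n *s s" for n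
    using approx[of n] idempotent_newton_step(1)[OF assoc] unfolding a_Suc by blast
  then obtain e where e: "\<And>n. \<exists>s. e - a n = fps_X ^ Suc n *s s"
    using X_adic_limit by blast
  have "vcoeff (D e e - e) n = 0" for n
  proof -
    obtain s where "e - a n = fps_X ^ Suc n *s s" using e by blast
    then have s: "e = a n + fps_X ^ Suc n *s s" by (simp add: algebra_simps)
    obtain r where r: "D (a n) (a n) - a n = fps_X ^ Suc n *s r" using approx by blast
    have "D e e - e = (D (a n) (a n) - a n) + fps_X ^ Suc n *s (D (a n) s + D s e - s)"
      by (simp add: s vec_eq_iff algebra_simps)
    also have "\<dots> = fps_X ^ Suc n *s (r + (D (a n) s + D s e - s))"
      by (simp only: r vector_add_ldistrib)
    finally show ?thesis
      using X_power_multiple_iff[of "D e e - e" "Suc n"] by blast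
  qed
  then have "D e e = e"
    by (simp add: vec_eq_iff vcoeff_nth fps_eq_iff)
  moreover have "vcoeff e 0 = v"
    using e[of 0] unfolding X_power_multiple_iff by (simp add: vcoeff_diff a_def vcoeff_vconst)
  ultimately show thesis by (rule that)
qed


section \<open>Bases lifting the standard basis\<close>

definition lifts_basis :: "(3 \<Rightarrow> complex fps ^ 3) \<Rightarrow> bool" where
  "lifts_basis b \<longleftrightarrow> (\<forall>i. vcoeff (b i) 0 = axis i 1)"

definition combine :: "(3 \<Rightarrow> 'a::comm_ring_1 ^ 3) \<Rightarrow> 'a ^ 3 \<Rightarrow> 'a ^ 3" where
  "combine b x = x $ 1 *s b 1 + x $ 2 *s b 2 + x $ 3 *s b 3"

lemma combine_linear:
  "combine b (x + y) = combine b x + combine b y" "combine b (c *s x) = c *s combine b x"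
  "combine b 0 = 0"
  by (simp_all add: combine_def vec_eq_iff algebra_simps)

lemma combine_axis: "combine b (axis k 1) = b k"
  using exhaust_3[of k] by (auto simp: combine_def axis_def)

lemma vcoeff_combine: "lifts_basis b \<Longrightarrow> vcoeff (combine b x) 0 = vcoeff x 0"
  by (simp add: combine_def lifts_basis_def vcoeff_add vcoeff_scale vec3_eq_iff axis_def vcoeff_nth)

lemma lifts_basis_nonzero:
  assumes "lifts_basis b"
  shows "b i \<noteq> 0"
proof
  assume "b i = 0"
  then have "axis i 1 $ i = vcoeff 0 0 $ i"
    using assms unfolding lifts_basis_def by metis
  then show False by (simp add: vcoeff_nth)
qed

text \<open>
  Modulo \<open>t\<close> the vectors form the standard basis, so their determinant has constant term 1 and
  is a unit of \<open>\<complex>[[t]]\<close>; the inverse is given by Cramer's rule.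
\<close>

lemma bij_combine:
  assumes "lifts_basis b"
  shows "bij (combine b)"
proof -
  define det where "det u v w = u$1 * (v$2 * w$3 - v$3 * w$2) - u$2 * (v$1 * w$3 - v$3 * w$1)
    + u$3 * (v$1 * w$2 - v$2 * w$1)" for u v w :: "complex fps ^ 3"
  define \<delta> where "\<delta> = det (b 1) (b 2) (b 3)"
  have "fps_nth (b i $ j) 0 = (if i = j then 1 else 0)" for i j
    using assms by (simp add: lifts_basis_def vec_eq_iff vcoeff_nth axis_def)
  then have "fps_nth \<delta> 0 = 1"
    by (simp add: \<delta>_def det_def)
  then have inv: "inverse \<delta> * \<delta> = 1"
    by (intro inverse_mult_eq_1) simp
  define g where "g x = inverse \<delta> *s
      (vector [det x (b 2) (b 3), det (b 1) x (b 3), det (b 1) (b 2) x] :: complex fps ^ 3)"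
    for x :: "complex fps ^ 3"
  have gc: "g (combine b x) = x" for x
  proof -
    have "det (combine b x) (b 2) (b 3) = \<delta> * x $ 1" "det (b 1) (combine b x) (b 3) = \<delta> * x $ 2"
      "det (b 1) (b 2) (combine b x) = \<delta> * x $ 3"
      by (simp_all add: \<delta>_def det_def combine_def algebra_simps)
    then have "g (combine b x) = (inverse \<delta> * \<delta>) *s x"
      by (simp add: g_def vec3_eq_iff vector_3 mult.assoc)
    then show ?thesis by (simp add: inv)
  qed
  have cg: "combine b (g x) = x" for x
  proof -
    have "det x (b 2) (b 3) *s b 1 + det (b 1) x (b 3) *s b 2 + det (b 1) (b 2) x *s b 3 = \<delta> *s x"
      by (simp add: vec3_eq_iff \<delta>_def det_def algebra_simps)
    moreover have "combine b (g x) = inverse \<delta> *s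
       (det x (b 2) (b 3) *s b 1 + det (b 1) x (b 3) *s b 2 + det (b 1) (b 2) x *s b 3)"
      by (simp add: combine_def g_def vector_3 vector_add_ldistrib vector_smult_assoc)
    ultimately have "combine b (g x) = (inverse \<delta> * \<delta>) *s x"
      by (simp add: vector_smult_assoc)
    then show ?thesis by (simp add: inv)
  qed
  show ?thesis
    by (rule o_bij[of g]) (auto simp: fun_eq_iff gc cg)
qed

lemma combine_eqD: "lifts_basis b \<Longrightarrow> combine b x = combine b y \<Longrightarrow> x = y"
  using bij_combine by (metis bij_pointE)

lemma combine_surjE:
  assumes "lifts_basis b"
  obtains c where "z = combine b c"
  using bij_combine[OF assms] by (metis bij_pointE)

text \<open>
  The inverse of \<open>combine b\<close> is the required equivalence: it is the identity modulo \<open>t\<close> because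
  \<open>b\<close> reduces to the standard basis.
\<close>

lemma trivial_deformationI:
  assumes def: "formal_deformation d D" and b: "lifts_basis b"
    and table: "\<And>i j. D (b i) (b j) = combine b (vconst (d (axis i 1) (axis j 1)))"
  shows "trivial_deformation d D"
proof -
  let ?\<Psi> = "combine b"
  let ?\<Phi> = "inv ?\<Psi>"
  have bij: "bij ?\<Psi>" using b by (rule bij_combine)
  then have \<Psi>\<Phi>: "?\<Psi> (?\<Phi> x) = x" and \<Phi>\<Psi>: "?\<Phi> (?\<Psi> x) = x" for x
    by (simp_all add: bij_is_surj surj_f_inv_f bij_is_inj)
  note [simp] = assoc_algebraD[OF formal_deformation_assoc[OF def]]
  have hom: "?\<Psi> (extend_product d x y) = D (?\<Psi> x) (?\<Psi> y)" for x y
    unfolding extend_product_def sum_3 combine_linear table[symmetric]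
    by (simp add: combine_def vec_eq_iff algebra_simps)
  have "?\<Phi> (D x y) = extend_product d (?\<Phi> x) (?\<Phi> y)" for x y
    by (rule combine_eqD[OF b]) (simp only: hom \<Psi>\<Phi>)
  moreover have "?\<Phi> (x + y) = ?\<Phi> x + ?\<Phi> y" "?\<Phi> (c *s x) = c *s ?\<Phi> x" for x y c
    by (rule combine_eqD[OF b]; simp only: combine_linear \<Psi>\<Phi>)+
  moreover have "vcoeff (?\<Phi> x) 0 = vcoeff x 0" for x
    using vcoeff_combine[OF b, of "?\<Phi> x"] by (simp only: \<Psi>\<Phi>)
  moreover have "bij ?\<Phi>" using bij by (rule bij_imp_bij_inv)
  ultimately show ?thesis
    unfolding trivial_deformation_def algebra_iso_def module_hom_vec3_iff by blast
qed


section \<open>Peirce decomposition\<close>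

text \<open>
  The four Peirce spaces of an idempotent \<open>f\<close>: \<open>l\<close> and \<open>r\<close> tell whether \<open>f\<close> acts on \<open>x\<close> from the left
  and from the right as 1 or as 0.
\<close>

definition peirce :: "'a::comm_ring_1 prod3 \<Rightarrow> 'a ^ 3 \<Rightarrow> bool \<Rightarrow> bool \<Rightarrow> 'a ^ 3 \<Rightarrow> bool" where
  "peirce D f l r x \<longleftrightarrow> D f x = (if l then x else 0) \<and> D x f = (if r then x else 0)"

lemma peirce_mult:
  assumes "assoc_algebra D" "peirce D f l r x" "peirce D f l' r' y"
  shows "peirce D f l r' (D x y)"
proof -
  note laws = assoc_algebraD[OF assms(1)]
  have "D f (D x y) = D (D f x) y" "D (D x y) f = D x (D y f)"
    by (simp_all only: laws)
  then show ?thesis using assms(2,3) laws(7,8) by (simp add: peirce_def)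
qed

lemma peirce_mult_zero:
  assumes "assoc_algebra D" "peirce D f l r x" "peirce D f l' r' y" "r \<noteq> l'"
  shows "D x y = 0"
proof -
  note laws = assoc_algebraD[OF assms(1)]
  have "D (D x f) y = D x (D f y)"
    by (simp only: laws)
  then show ?thesis using assms(2-4) laws(7,8)
    by (cases r) (simp_all add: peirce_def)
qed

text \<open>
  Multiplication by \<open>f\<close> is diagonal in the basis \<open>b\<close>, so coordinates with the wrong eigenvalues
  vanish.
\<close>

lemma peirce_coordinates:
  assumes "assoc_algebra D" "lifts_basis b" "\<And>i. peirce D f (l i) (r i) (b i)"
    and z: "peirce D f l' r' (combine b c)" and k: "l k \<noteq> l' \<or> r k \<noteq> r'"
  shows "c $ k = 0"
proof -
  note [simp] = assoc_algebraD[OF assms(1)]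
  have l1: "D f (combine b c) = combine b (\<chi> i. if l i then c $ i else 0)"
    using assms(3) by (simp add: combine_def peirce_def)
  have l2: "D f (combine b c) = combine b (if l' then c else 0)"
    using z by (simp add: peirce_def combine_linear)
  have L: "(\<chi> i. if l i then c $ i else 0) = (if l' then c else 0)"
    by (rule combine_eqD[OF assms(2) trans[OF l1[symmetric] l2]])
  have r1: "D (combine b c) f = combine b (\<chi> i. if r i then c $ i else 0)"
    using assms(3) by (simp add: combine_def peirce_def)
  have r2: "D (combine b c) f = combine b (if r' then c else 0)"
    using z by (simp add: peirce_def combine_linear)
  have R: "(\<chi> i. if r i then c $ i else 0) = (if r' then c else 0)"
    by (rule combine_eqD[OF assms(2) trans[OF r1[symmetric] r2]])
  have "(if l k then c $ k else 0) = (if l' then c $ k else 0)"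
    using arg_cong[OF L, of "\<lambda>x. x $ k"] by (cases l') simp_all
  moreover have "(if r k then c $ k else 0) = (if r' then c $ k else 0)"
    using arg_cong[OF R, of "\<lambda>x. x $ k"] by (cases r') simp_all
  ultimately show ?thesis using k by metis
qed

lemma peirce_eq_0:
  assumes "assoc_algebra D" "lifts_basis b" "\<And>i. peirce D f (l i) (r i) (b i)"
    and "peirce D f l' r' z" "\<And>i. l i \<noteq> l' \<or> r i \<noteq> r'"
  shows "z = 0"
proof -
  obtain c where z: "z = combine b c" using assms(2) by (rule combine_surjE)
  have "c $ i = 0" for i
    using peirce_coordinates[OF assms(1-3)] assms(4,5) unfolding z by blast
  then have "c = 0" by (simp add: vec_eq_iff)
  then show ?thesis by (simp add: z combine_linear)
qed

lemma peirce_eq_multiple: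
  assumes "assoc_algebra D" "lifts_basis b" "\<And>i. peirce D f (l i) (r i) (b i)"
    and "peirce D f l' r' z" "\<And>i. i \<noteq> k \<Longrightarrow> l i \<noteq> l' \<or> r i \<noteq> r'"
  obtains c where "z = c *s b k"
proof -
  obtain c where z: "z = combine b c" using assms(2) by (rule combine_surjE)
  have "c $ i = 0" if "i \<noteq> k" for i
    using peirce_coordinates[OF assms(1-3)] assms(4) assms(5)[OF that] unfolding z by blast
  then have "c = c $ k *s axis k 1" by (simp add: vec_eq_iff axis_def)
  then have "z = c $ k *s b k" by (metis z combine_linear(2) combine_axis)
  then show thesis by (rule that)
qed

text \<open>
  Peirce bases lift along deformations: \<open>e\<^sub>m\<close> lifts to an idempotent \<open>f\<close>, and the projections
  \<open>x \<mapsto> f x\<close> or \<open>x \<mapsto> x - f x\<close>, followed by their right-hand analogues, map \<open>e\<^sub>i\<close> into the Peirce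
  space of \<open>f\<close> that corresponds to its own. Modulo \<open>t\<close> they fix \<open>e\<^sub>i\<close>.
\<close>

lemma peirce_basis:
  assumes def: "formal_deformation d D" and m: "l m" "r m"
    and d: "\<And>i. peirce d (axis m 1) (l i) (r i) (axis i 1)"
  shows "\<exists>b. lifts_basis b \<and> (\<forall>i. peirce D (b m) (l i) (r i) (b i))"
proof -
  note [simp] = assoc_algebraD[OF formal_deformation_assoc[OF def]]
  have "d (axis m 1) (axis m 1) = axis m 1"
    using d[of m] m by (simp add: peirce_def)
  then obtain f where f: "D f f = f" "vcoeff f 0 = axis m 1"
    by (rule lift_idempotent[OF def])
  have ff: "D f (D f x) = D f x" for x
    using assoc_algebraD(9)[OF formal_deformation_assoc[OF def], of f f x] f(1) by simp
  define L where "L i x = (if l i then D f x else x - D f x)" for i x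
  define R where "R i x = (if r i then D x f else x - D x f)" for i x
  have red: "vcoeff (D x y) 0 = d (vcoeff x 0) (vcoeff y 0)" for x y
    by (rule formal_deformation_reduce[OF def])
  have P: "peirce D f (l i) (r i) (R i (L i x))" for i x
    by (simp add: L_def R_def peirce_def ff f(1))
  have L0: "vcoeff (L i (axis i 1)) 0 = axis i 1" for i
    using d[of i] by (simp add: L_def peirce_def vcoeff_diff red vcoeff_axis f(2))
  have R0: "vcoeff (R i x) 0 = axis i 1" if "vcoeff x 0 = axis i 1" for i x
    using d[of i] that by (simp add: R_def peirce_def vcoeff_diff red f(2))
  \<comment> \<open>The projection of \<open>e\<^sub>m\<close> would be \<open>f e\<^sub>m f\<close>, which need not be \<open>f\<close>.\<close>
  define b where "b i = (if i = m then f else R i (L i (axis i 1)))" for i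
  show ?thesis
  proof (intro exI[of _ b] conjI allI)
    show "lifts_basis b"
      by (simp add: lifts_basis_def b_def f(2) R0 L0)
    show "peirce D (b m) (l i) (r i) (b i)" for i
      using P m f(1) by (simp add: b_def, simp add: peirce_def)
  qed
qed


section \<open>Rigid algebras\<close>

lemma vconst_0: "vconst 0 = 0"
  by (simp add: vec_eq_iff vconst_nth)

lemmas table_simps = forall_3 psi_axis vconst_axis vconst_0 combine_axis combine_linear

lemma scale_eq_0D: "c *s v = 0 \<Longrightarrow> v \<noteq> 0 \<Longrightarrow> c = 0" for c :: "'a::idom"
  by (auto simp: vec_eq_iff)

text \<open>
  Transfers results on left multiplication to right multiplication; \<open>d11\<close> is the mirror image of
  \<open>d10\<close> up to the numbering of the basis.
\<close>

lemma formal_deformation_opposite: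
  assumes "formal_deformation d D"
  shows "formal_deformation (\<lambda>x y. d y x) (\<lambda>x y. D y x)"
proof (rule formal_deformationI)
  note laws = assoc_algebraD[OF formal_deformation_assoc[OF assms]]
  show "assoc_algebra (\<lambda>x y. D y x)"
    by (rule assoc_algebraI) (simp_all add: laws)
  show "vcoeff (D (vconst w) (vconst v)) 0 = d w v" for v w
    by (simp add: formal_deformation_reduce[OF assms] vcoeff_vconst)
qed

text \<open>
  If a second idempotent \<open>e\<^sub>i\<close> lies in a Peirce space of rank one, then its lift \<open>b\<^sub>i\<close> has the
  square \<open>u b\<^sub>i\<close> with a unit \<open>u\<close>, and \<open>u\<^sup>-\<^sup>1 b\<^sub>i\<close> is idempotent. An idempotent acts on the line through
  \<open>b\<^sub>j\<close> by a scalar \<open>e\<close> with \<open>e\<^sup>2 = e\<close>, so \<open>e\<close> is 0 or 1, and reduction modulo \<open>t\<close> decides which.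
\<close>

lemma normalize_idempotent:
  assumes def: "formal_deformation d D" and b: "lifts_basis b"
    and u: "D (b i) (b i) = u *s b i" and c: "D (b i) (b j) = c *s b j"
    and ii: "d (axis i 1) (axis i 1) = axis i 1"
    and ij: "d (axis i 1) (axis j 1) = (if \<gamma> then axis j 1 else 0)"
  defines "p \<equiv> inverse u *s b i"
  shows "D p p = p" "D p (b j) = (if \<gamma> then b j else 0)" "vcoeff p 0 = axis i 1"
proof -
  note laws = assoc_algebraD[OF formal_deformation_assoc[OF def]]
  have red: "vcoeff (D (b k) (b l)) 0 = d (axis k 1) (axis l 1)" for k l
    using formal_deformation_reduce[OF def] b by (simp add: lifts_basis_def)
  have b0: "vcoeff (b k) 0 = axis k 1" for k
    using b by (simp add: lifts_basis_def)
  have "(fps_nth u 0 *s axis i 1) $ i = axis i (1::complex) $ i"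
    using red[of i i] by (simp add: u vcoeff_scale b0 ii)
  then have u0: "fps_nth u 0 = 1" by (simp add: axis_def)
  then have inv: "inverse u * u = 1" by (intro inverse_mult_eq_1) simp
  show pp: "D p p = p"
    by (simp add: p_def laws u vector_smult_assoc mult.assoc inv)
  show "vcoeff p 0 = axis i 1"
    by (simp add: p_def vcoeff_scale b0 u0)
  define e where "e = inverse u * c"
  have pb: "D p (b j) = e *s b j"
    by (simp add: p_def e_def laws c vector_smult_assoc)
  have "e *s (e *s b j) = D p (D p (b j))"
    by (simp add: pb laws)
  also have "\<dots> = e *s b j"
    using laws(9)[of p p "b j"] by (simp add: pp pb)
  finally have "(e * (e - 1)) *s b j = 0"
    by (simp add: vec_eq_iff algebra_simps)
  then have "e * (e - 1) = 0"
    using lifts_basis_nonzero[OF b] by (rule scale_eq_0D)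
  then have e: "e = 0 \<or> e = 1" by simp
  have "fps_nth c 0 *s axis j 1 = (if \<gamma> then axis j 1 else (0 :: complex ^ 3))"
    using red[of i j] by (simp add: c vcoeff_scale b0 ij)
  from arg_cong[OF this, of "\<lambda>x. x $ j"] have "fps_nth e 0 = (if \<gamma> then 1 else 0)"
    by (simp add: e_def u0 axis_def split: if_splits)
  with e show "D p (b j) = (if \<gamma> then b j else 0)"
    by (auto simp: pb split: if_splits)
qed

text \<open>
  In \<open>d8\<close> and \<open>d20\<close> the eigenvalues already force all products.
\<close>

lemma d8_rigid: "no_nontrivial_deformations d8"
  unfolding no_nontrivial_deformations_def
proof (intro allI impI)
  fix D assume def: "formal_deformation d8 D"
  note assoc = formal_deformation_assoc[OF def]
  have "\<forall>i. peirce d8 (axis 1 1) (i = 1) True (axis i 1)"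
    by (simp add: peirce_def forall_3 d8_def psi_axis)
  then obtain b where b: "lifts_basis b" and P: "\<And>i. peirce D (b 1) (i = 1) True (b i)"
    using peirce_basis[OF def, of "\<lambda>i. i = 1" 1 "\<lambda>i. True"] index3_neq by blast
  have unit: "D (b 1) (b i) = (if i = 1 then b i else 0)"
    "D (b i) (b 1) = b i" for i
    using P[of i] by (simp_all add: peirce_def)
  have "D (b i) (b j) = 0" if "j \<noteq> 1" for i j
    using peirce_mult_zero[OF assoc P P] that by simp
  with unit have "\<forall>i j. D (b i) (b j) = combine b (vconst (d8 (axis i 1) (axis j 1)))"
    by (simp add: table_simps d8_def)
  then show "trivial_deformation d8 D"
    using trivial_deformationI[OF def b] by blast
qed

lemma d20_rigid: "no_nontrivial_deformations d20"
  unfolding no_nontrivial_deformations_def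
proof (intro allI impI)
  fix D assume def: "formal_deformation d20 D"
  note assoc = formal_deformation_assoc[OF def]
  have "\<forall>i. peirce d20 (axis 1 1) True (i = 1) (axis i 1)"
    by (simp add: peirce_def forall_3 d20_def psi_axis)
  then obtain b where b: "lifts_basis b" and P: "\<And>i. peirce D (b 1) True (i = 1) (b i)"
    using peirce_basis[OF def, of "\<lambda>i. True" 1 "\<lambda>i. i = 1"] index3_neq by blast
  have unit: "D (b 1) (b i) = b i"
    "D (b i) (b 1) = (if i = 1 then b i else 0)" for i
    using P[of i] by (simp_all add: peirce_def)
  have "D (b i) (b j) = 0" if "i \<noteq> 1" for i j
    using peirce_mult_zero[OF assoc P P] that by simp
  with unit have "\<forall>i j. D (b i) (b j) = combine b (vconst (d20 (axis i 1) (axis j 1)))"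
    by (simp add: table_simps d20_def)
  then show "trivial_deformation d20 D"
    using trivial_deformationI[OF def b] by blast
qed

text \<open>
  The product \<open>b\<^sub>3 b\<^sub>2\<close> lies in the line of the idempotent \<open>b\<^sub>1\<close> and is not forced by the
  eigenvalues, but \<open>b\<^sub>2 b\<^sub>3 = 0\<close> and associativity of \<open>b\<^sub>3 b\<^sub>2 b\<^sub>3\<close> kill it.
\<close>

lemma d7_rigid: "no_nontrivial_deformations d7"
  unfolding no_nontrivial_deformations_def
proof (intro allI impI)
  fix D assume def: "formal_deformation d7 D"
  note assoc = formal_deformation_assoc[OF def]
  note laws = assoc_algebraD[OF assoc]
  have "\<forall>i. peirce d7 (axis 1 1) (i \<noteq> 2) (i \<noteq> 3) (axis i 1)"
    by (simp add: peirce_def forall_3 d7_def psi_axis)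
  then obtain b where b: "lifts_basis b" and P: "\<And>i. peirce D (b 1) (i \<noteq> 2) (i \<noteq> 3) (b i)"
    using peirce_basis[OF def, of "\<lambda>i. i \<noteq> 2" 1 "\<lambda>i. i \<noteq> 3"] index3_neq by blast
  have unit: "D (b 1) (b i) = (if i \<noteq> 2 then b i else 0)"
    "D (b i) (b 1) = (if i \<noteq> 3 then b i else 0)" for i
    using P[of i] by (simp_all add: peirce_def)
  have 22: "D (b 2) (b 2) = 0" and 33: "D (b 3) (b 3) = 0"
    using peirce_mult_zero[OF assoc P P] by simp_all
  have 23: "D (b 2) (b 3) = 0"
    using peirce_mult[OF assoc P[of 2] P[of 3]] by (rule peirce_eq_0[OF assoc b P]) simp
  obtain c where c: "D (b 3) (b 2) = c *s b 1"
    using peirce_mult[OF assoc P[of 3] P[of 2]]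
    by (rule peirce_eq_multiple[OF assoc b P, where k = 1]) (metis exhaust_3 index3_neq)
  have "c *s b 3 = D (D (b 3) (b 2)) (b 3)"
    using unit(1)[of 3] by (simp add: c laws)
  also have "\<dots> = 0"
    by (simp add: laws 23)
  finally have "c = 0"
    using lifts_basis_nonzero[OF b] by (rule scale_eq_0D)
  with c have 32: "D (b 3) (b 2) = 0" by simp
  from unit 22 23 32 33 have "\<forall>i j. D (b i) (b j) = combine b (vconst (d7 (axis i 1) (axis j 1)))"
    by (simp add: table_simps d7_def)
  then show "trivial_deformation d7 D"
    using trivial_deformationI[OF def b] by blast
qed

text \<open>
  For \<open>d10\<close>, \<open>d13\<close> and \<open>d11\<close> the Peirce space for the eigenvalues 0, 0 has rank one. What the
  eigenvalues leave open is the square of its generator and the one-sided action of the generator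
  on the nilpotent basis vector.
\<close>

lemma d10_rigid: "no_nontrivial_deformations d10"
  unfolding no_nontrivial_deformations_def
proof (intro allI impI)
  fix D assume def: "formal_deformation d10 D"
  note assoc = formal_deformation_assoc[OF def]
  note laws = assoc_algebraD[OF assoc]
  have "\<forall>i. peirce d10 (axis 1 1) (i = 1) (i \<noteq> 3) (axis i 1)"
    by (simp add: peirce_def forall_3 d10_def psi_axis)
  then obtain b where b: "lifts_basis b" and P: "\<And>i. peirce D (b 1) (i = 1) (i \<noteq> 3) (b i)"
    using peirce_basis[OF def, of "\<lambda>i. i = 1" 1 "\<lambda>i. i \<noteq> 3"] index3_neq by blast
  have unit: "D (b 1) (b i) = (if i = 1 then b i else 0)"
    "D (b i) (b 1) = (if i \<noteq> 3 then b i else 0)" for i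
    using P[of i] by (simp_all add: peirce_def)
  have zero: "D (b 2) (b 2) = 0" "D (b 2) (b 3) = 0"
    using peirce_mult_zero[OF assoc P P] by simp_all
  obtain u where u: "D (b 3) (b 3) = u *s b 3"
    using peirce_mult[OF assoc P[of 3] P[of 3]]
    by (rule peirce_eq_multiple[OF assoc b P, where k = 3]) (metis exhaust_3 index3_neq)
  obtain c where c: "D (b 3) (b 2) = c *s b 2"
    using peirce_mult[OF assoc P[of 3] P[of 2]]
    by (rule peirce_eq_multiple[OF assoc b P, where k = 2]) (metis exhaust_3 index3_neq)
  define p where "p = inverse u *s b 3"
  have p: "D p p = p" "D p (b 2) = 0" "vcoeff p 0 = axis 3 1"
    using normalize_idempotent[OF def b u c, of False] by (simp_all add: p_def d10_def psi_axis)
  have "D (b 1) p = 0" "D p (b 1) = 0" "D (b 2) p = 0"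
    using zero unit[of 3] by (simp_all add: p_def laws)
  with zero p unit have "\<forall>i j. D ((b(3 := p)) i) ((b(3 := p)) j)
      = combine (b(3 := p)) (vconst (d10 (axis i 1) (axis j 1)))"
    by (simp add: table_simps d10_def)
  moreover have "lifts_basis (b(3 := p))"
    using b p(3) by (simp add: lifts_basis_def)
  ultimately show "trivial_deformation d10 D"
    using trivial_deformationI[OF def] by blast
qed

lemma d13_rigid: "no_nontrivial_deformations d13"
  unfolding no_nontrivial_deformations_def
proof (intro allI impI)
  fix D assume def: "formal_deformation d13 D"
  note assoc = formal_deformation_assoc[OF def]
  note laws = assoc_algebraD[OF assoc]
  have "\<forall>i. peirce d13 (axis 1 1) (i = 1) (i \<noteq> 2) (axis i 1)"
    by (simp add: peirce_def forall_3 d13_def psi_axis)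
  then obtain b where b: "lifts_basis b" and P: "\<And>i. peirce D (b 1) (i = 1) (i \<noteq> 2) (b i)"
    using peirce_basis[OF def, of "\<lambda>i. i = 1" 1 "\<lambda>i. i \<noteq> 2"] index3_neq by blast
  have unit: "D (b 1) (b i) = (if i = 1 then b i else 0)"
    "D (b i) (b 1) = (if i \<noteq> 2 then b i else 0)" for i
    using P[of i] by (simp_all add: peirce_def)
  have zero: "D (b 3) (b 3) = 0" "D (b 3) (b 2) = 0"
    using peirce_mult_zero[OF assoc P P] by simp_all
  obtain u where u: "D (b 2) (b 2) = u *s b 2"
    using peirce_mult[OF assoc P[of 2] P[of 2]]
    by (rule peirce_eq_multiple[OF assoc b P, where k = 2]) (metis exhaust_3 index3_neq)
  obtain c where c: "D (b 2) (b 3) = c *s b 3"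
    using peirce_mult[OF assoc P[of 2] P[of 3]]
    by (rule peirce_eq_multiple[OF assoc b P, where k = 3]) (metis exhaust_3 index3_neq)
  define p where "p = inverse u *s b 2"
  have p: "D p p = p" "D p (b 3) = b 3" "vcoeff p 0 = axis 2 1"
    using normalize_idempotent[OF def b u c, of True] by (simp_all add: p_def d13_def psi_axis)
  have "D (b 1) p = 0" "D p (b 1) = 0" "D (b 3) p = 0"
    using zero unit[of 2] by (simp_all add: p_def laws)
  with zero p unit have "\<forall>i j. D ((b(2 := p)) i) ((b(2 := p)) j)
      = combine (b(2 := p)) (vconst (d13 (axis i 1) (axis j 1)))"
    by (simp add: table_simps d13_def)
  moreover have "lifts_basis (b(2 := p))"
    using b p(3) by (simp add: lifts_basis_def)
  ultimately show "trivial_deformation d13 D"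
    using trivial_deformationI[OF def] by blast
qed

lemma d11_rigid: "no_nontrivial_deformations d11"
  unfolding no_nontrivial_deformations_def
proof (intro allI impI)
  fix D assume def: "formal_deformation d11 D"
  note assoc = formal_deformation_assoc[OF def]
  note laws = assoc_algebraD[OF assoc]
  have "\<forall>i. peirce d11 (axis 2 1) (i \<noteq> 1) (i = 2) (axis i 1)"
    by (simp add: peirce_def forall_3 d11_def psi_axis)
  then obtain b where b: "lifts_basis b" and P: "\<And>i. peirce D (b 2) (i \<noteq> 1) (i = 2) (b i)"
    using peirce_basis[OF def, of "\<lambda>i. i \<noteq> 1" 2 "\<lambda>i. i = 2"] index3_neq by blast
  have unit: "D (b 2) (b i) = (if i \<noteq> 1 then b i else 0)"
    "D (b i) (b 2) = (if i = 2 then b i else 0)" for i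
    using P[of i] by (simp_all add: peirce_def)
  have zero: "D (b 3) (b 3) = 0" "D (b 1) (b 3) = 0"
    using peirce_mult_zero[OF assoc P P] by simp_all
  obtain u where u: "D (b 1) (b 1) = u *s b 1"
    using peirce_mult[OF assoc P[of 1] P[of 1]]
    by (rule peirce_eq_multiple[OF assoc b P, where k = 1]) (metis exhaust_3 index3_neq)
  obtain c where c: "D (b 3) (b 1) = c *s b 3"
    using peirce_mult[OF assoc P[of 3] P[of 1]]
    by (rule peirce_eq_multiple[OF assoc b P, where k = 3]) (metis exhaust_3 index3_neq)
  define p where "p = inverse u *s b 1"
  have p: "D p p = p" "D (b 3) p = 0" "vcoeff p 0 = axis 1 1"
    using normalize_idempotent[OF formal_deformation_opposite[OF def] b u c, of False]
    by (simp_all add: p_def d11_def psi_axis)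
  have "D (b 2) p = 0" "D p (b 2) = 0" "D p (b 3) = 0"
    using zero unit[of 1] by (simp_all add: p_def laws)
  with zero p unit have "\<forall>i j. D ((b(1 := p)) i) ((b(1 := p)) j)
      = combine (b(1 := p)) (vconst (d11 (axis i 1) (axis j 1)))"
    by (simp add: table_simps d11_def)
  moreover have "lifts_basis (b(1 := p))"
    using b p(3) by (simp add: lifts_basis_def)
  ultimately show "trivial_deformation d11 D"
    using trivial_deformationI[OF def] by blast
qed

text \<open>
  Write \<open>g = c b\<^sub>m + g'\<close> with \<open>g'\<close> annihilated by \<open>b\<^sub>m\<close> on both sides. Then \<open>c\<^sup>2 = c\<close>, and \<open>c\<close> vanishes
  modulo \<open>t\<close>, so \<open>c = 0\<close>.
\<close>

lemma orthogonal_idempotents: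
  assumes def: "formal_deformation d D" and b: "lifts_basis b"
    and P: "\<And>i. peirce D (b m) (i = m) (i = m) (b i)"
    and g: "D g g = g" "vcoeff g 0 $ m = 0"
  shows "D (b m) g = 0" "D g (b m) = 0"
proof -
  note laws = assoc_algebraD[OF formal_deformation_assoc[OF def]]
  obtain c where c: "g = combine b c" using b by (rule combine_surjE)
  have Pm: "D (b m) (b i) = (if i = m then b m else 0)"
    "D (b i) (b m) = (if i = m then b m else 0)" for i
    using P[of i] by (auto simp: peirce_def)
  have bg: "D (b m) g = c $ m *s b m" "D g (b m) = c $ m *s b m"
    using exhaust_3[of m] by (auto simp: c combine_def laws Pm)
  have "c $ m *s (c $ m *s b m) = D (D (b m) g) g"
    by (simp add: bg laws(5))
  also have "\<dots> = D (b m) (D g g)"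
    by (rule laws(9))
  also have "\<dots> = c $ m *s b m"
    by (simp only: g(1) bg(1))
  finally have "(c $ m * (c $ m - 1)) *s b m = 0"
    by (simp add: vec_eq_iff algebra_simps)
  then have "c $ m * (c $ m - 1) = 0"
    using lifts_basis_nonzero[OF b] by (rule scale_eq_0D)
  moreover have "fps_nth (c $ m) 0 = 0"
    using g(2) vcoeff_combine[OF b, of c] by (simp add: c vcoeff_nth)
  ultimately have "c $ m = 0" by auto
  with bg show "D (b m) g = 0" "D g (b m) = 0" by simp_all
qed

text \<open>
  A Peirce basis for one idempotent would leave a Peirce space of rank two to be decomposed.
  Lifting all three idempotents independently avoids this, because the lifts are automatically
  orthogonal.
\<close>

lemma d14_rigid: "no_nontrivial_deformations d14"
  unfolding no_nontrivial_deformations_def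
proof (intro allI impI)
  fix D assume def: "formal_deformation d14 D"
  have "\<exists>b. lifts_basis b \<and> (\<forall>i. peirce D (b m) (i = m) (i = m) (b i))" for m
  proof -
    have "\<forall>m i. peirce d14 (axis m 1) (i = m) (i = m) (axis i 1)"
      by (simp add: peirce_def forall_3 d14_def psi_axis)
    then have "peirce d14 (axis m 1) (i = m) (i = m) (axis i 1)" for i
      by blast
    then show ?thesis
      by (rule peirce_basis[OF def, where l = "\<lambda>i. i = m" and r = "\<lambda>i. i = m", OF refl refl])
  qed
  then obtain B where B: "lifts_basis (B m)" and P: "peirce D (B m m) (i = m) (i = m) (B m i)" for m i
    by metis
  define f where "f m = B m m" for m
  have f: "lifts_basis f"
    using B by (simp add: f_def lifts_basis_def)
  have idem: "D (f m) (f m) = f m" for m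
    using P[of m m] by (simp add: f_def peirce_def)
  have "D (f m) (f n) = 0" if "m \<noteq> n" for m n
  proof -
    have "vcoeff (f n) 0 $ m = 0"
      using f that by (simp add: lifts_basis_def axis_def)
    then show ?thesis
      using orthogonal_idempotents(1)[OF def B P idem] by (simp add: f_def)
  qed
  with idem have "\<forall>i j. D (f i) (f j) = combine f (vconst (d14 (axis i 1) (axis j 1)))"
    by (simp add: table_simps d14_def)
  then show "trivial_deformation d14 D"
    using trivial_deformationI[OF def f] by blast
qed


section \<open>Jump deformations\<close>

lemma isomorphic_refl: "isomorphic d d"
  unfolding isomorphic_def algebra_iso_def module_hom_vec3_iff by (intro exI[of _ id]) auto

text \<open>
  Convergent power series are continuous at \<open>t = 0\<close>, so a linear equation between coordinates of
  products that holds in all algebras isomorphic to \<open>d'\<close> survives in the limit \<open>d\<close>.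
\<close>

lemma jump_limit_equation:
  assumes "jump_deformation d d'"
    and eq: "\<And>D. isomorphic D d' \<Longrightarrow> D x y $ i = D x y $ j"
  shows "d x y $ i = d x y $ j"
proof -
  obtain \<psi> D where \<psi>: "\<psi> 0 = d"
    and sums: "\<forall>\<^sub>F t in nhds 0. \<forall>v w. (\<lambda>n. t ^ n *s \<psi> n v w) sums D t v w"
    and iso: "\<forall>\<^sub>F t in at 0. isomorphic (D t) d'"
    using assms(1) unfolding jump_deformation_def by (auto simp: eventually_conj_iff)
  obtain s where s: "0 < s" "\<And>t v w. norm t < s \<Longrightarrow> (\<lambda>n. t ^ n *s \<psi> n v w) sums D t v w"
    using sums unfolding eventually_nhds_metric by (auto simp: dist_norm)
  have lim: "((\<lambda>t. D t x y $ k) \<longlongrightarrow> d x y $ k) (at 0)" for k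
  proof -
    have "(\<lambda>n. \<psi> n x y $ k * t ^ n) sums (D t x y $ k)" if "norm t < s" for t
      using bounded_linear.sums[OF bounded_linear_vec_nth s(2)[OF that, of x y], of k]
      by (simp add: mult.commute)
    from powser_limit_0[OF s(1) this] show ?thesis by (simp add: \<psi>)
  qed
  have "\<forall>\<^sub>F t in at 0. D t x y $ i = D t x y $ j"
    using iso by eventually_elim (rule eq)
  with lim[of i] have "((\<lambda>t. D t x y $ j) \<longlongrightarrow> d x y $ i) (at 0)"
    by (rule Lim_transform_eventually)
  from tendsto_unique[OF _ this lim] show ?thesis by simp
qed

text \<open>
  The product of \<open>d8\<close> is \<open>x y = y\<^sub>1 x\<close>, and that of \<open>d20\<close> is \<open>x y = x\<^sub>1 y\<close>.
\<close>

lemma isomorphic_d8_parallel: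
  assumes "isomorphic D d8"
  shows "\<exists>c. D x y = c *s x"
proof -
  obtain f where f: "\<And>c x. f (c *s x) = c *s f x" "inj f" "\<And>x y. f (D x y) = d8 (f x) (f y)"
    using assms unfolding isomorphic_def algebra_iso_def module_hom_vec3_iff bij_def by blast
  have "d8 v w = w $ 1 *s v" for v w
    by (simp add: d8_def vec3_eq_iff psi_nth)
  then have "f (D x y) = f (f y $ 1 *s x)"
    by (simp add: f)
  with f(2) show ?thesis by (auto dest: injD)
qed

lemma isomorphic_d20_parallel:
  assumes "isomorphic D d20"
  shows "\<exists>c. D x y = c *s y"
proof -
  obtain f where f: "\<And>c x. f (c *s x) = c *s f x" "inj f" "\<And>x y. f (D x y) = d20 (f x) (f y)"
    using assms unfolding isomorphic_def algebra_iso_def module_hom_vec3_iff bij_def by blast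
  have "d20 v w = v $ 1 *s w" for v w
    by (simp add: d20_def vec3_eq_iff psi_nth)
  then have "f (D x y) = f (f x $ 1 *s y)"
    by (simp add: f)
  with f(2) show ?thesis by (auto dest: injD)
qed

lemmas evaluation_simps = listed_algebra_defs coordinate_simps axis_def vec_lambda_beta one_index
  mult_1 mult_1_right mult_zero_left mult_zero_right zero_neq_one one_neq_zero

text \<open>
  Testing proportionality of \<open>x y\<close> and \<open>x\<close> on the single vector \<open>x = (1, 1, 1)\<close> suffices: it says
  that \<open>x y\<close> has equal coordinates, and among the listed algebras this holds only in \<open>d8\<close>.
  The case of \<open>d20\<close> is the mirror image.
\<close>

lemma no_jump_to_d8:
  assumes "d \<in> listed_algebras"
  shows "\<not> jump_deformation d d8"
proof
  assume jump: "jump_deformation d d8"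
  have "d 1 y $ i = d 1 y $ j" for y i j
    using jump
  proof (rule jump_limit_equation)
    show "D 1 y $ i = D 1 y $ j" if "isomorphic D d8" for D
      using isomorphic_d8_parallel[OF that, of 1 y] by auto
  qed
  then have "d 1 (axis k 1) $ 1 = d 1 (axis k 1) $ 2 \<and> d 1 (axis k 1) $ 2 = d 1 (axis k 1) $ 3" for k
    by blast
  from this[of 1] this[of 2] this[of 3] assms have "d = d8"
    unfolding listed_algebras_def
    by (elim UnE insertE emptyE CollectE exE conjE; simp only: evaluation_simps; simp)
  with jump show False
    by (simp add: jump_deformation_def isomorphic_refl)
qed

lemma no_jump_to_d20:
  assumes "d \<in> listed_algebras"
  shows "\<not> jump_deformation d d20"
proof
  assume jump: "jump_deformation d d20"
  have "d x 1 $ i = d x 1 $ j" for x i j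
    using jump
  proof (rule jump_limit_equation)
    show "D x 1 $ i = D x 1 $ j" if "isomorphic D d20" for D
      using isomorphic_d20_parallel[OF that, of x 1] by auto
  qed
  then have "d (axis k 1) 1 $ 1 = d (axis k 1) 1 $ 2 \<and> d (axis k 1) 1 $ 2 = d (axis k 1) 1 $ 3" for k
    by blast
  from this[of 1] this[of 2] this[of 3] assms have "d = d20"
    unfolding listed_algebras_def
    by (elim UnE insertE emptyE CollectE exE conjE; simp only: evaluation_simps; simp)
  with jump show False
    by (simp add: jump_deformation_def isomorphic_refl)
qed


section \<open>Classification of the rigid algebras\<close>

lemma rigid_iff:
  assumes "d \<in> listed_algebras"
  shows "no_nontrivial_deformations d \<longleftrightarrow> d \<in> {d7, d8, d10, d11, d13, d14, d20}"
proof
  assume "d \<in> {d7, d8, d10, d11, d13, d14, d20}"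
  then show "no_nontrivial_deformations d"
    using d7_rigid d8_rigid d10_rigid d11_rigid d13_rigid d14_rigid d20_rigid
    by (elim insertE emptyE) simp_all
next
  assume "no_nontrivial_deformations d"
  with assms show "d \<in> {d7, d8, d10, d11, d13, d14, d20}"
    using d1_nonrigid d2_nonrigid d3_nonrigid d4_nonrigid d5_nonrigid d6_nonrigid
      d9_nonrigid d12_nonrigid d15_nonrigid d16_nonrigid d17_nonrigid d18_nonrigid d19_nonrigid
      d21_nonrigid d22_nonrigid
    unfolding listed_algebras_def by (elim UnE insertE emptyE CollectE exE conjE) simp_all
qed

theorem mainTheorem2:
  shows "(\<forall>d \<in> listed_algebras.
            no_nontrivial_deformations d \<longleftrightarrow> d \<in> {d7, d8, d10, d11, d13, d14, d20}) \<and>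
         (\<forall>d \<in> listed_algebras. \<not> jump_deformation d d8 \<and> \<not> jump_deformation d d20)"
  using rigid_iff no_jump_to_d8 no_jump_to_d20 by blast

end
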